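(* Let $\operatorname{char}K\neq2$. The Poisson superalgebra $\mathbf P=\mathrm{Poisson}(V_0,V_1,V_2)$ admits an algebraic quantization: there is an associative product $*$ on $\mathbf P[t]=\mathbf P\otimes_K K[t]$, compatible with the $\mathbb Z_2$-grading $\mathbf P[t]=\mathbf P_{\bar0}[t]\oplus\mathbf P_{\bar1}[t]$, such that $a*b\equiv a\cdot b \pmod t$ and $a*b-(-1)^{|a||b|}b*a\equiv t\{a,b\}\pmod{t^2}$ for all $a,b\in\mathbf P$, and $f*t=t*f=ft$ for all $f\in\mathbf P[t]$.
   Context: Let $H_\infty=\Lambda(x_i,y_i\mid i\ge0)$ be the Grassmann algebra over $K$ on odd generators $x_i,y_i$, a Poisson superalgebra with bracket determined by $\{y_i,x_j\}=\delta_{ij}$, $\{x_i,x_j\}=\{y_i,y_j\}=0$ and the super Leibniz rule. For a $0/1$ tuple $\alpha$ with finite support write $x^\alpha=\prod x_i^{\alpha_i}$ (increasing order), similarly $y^\beta$, and $\bar\alpha=\max\{i:\alpha_i\ne0\}$. Let $\widetilde H$ be the space of formal sums $c\cdot1+\sum\lambda_{\alpha,\beta}x^\alpha y^\beta$ over monomials with $\beta\ne0$ and $\bar\alpha<\bar\beta$; the product and bracket of $H_\infty$ extend to $\widetilde H$ (each coefficient of a product or bracket is a finite sum), making it a Poisson superalgebra. Put $V_i=\sum_{k\ge0}\big(\prod_{n=0}^{k-1}x_{i+3n}x_{i+3n+1}\big)y_{i+3k}\in\widetilde H$, and let $\mathbf P$ be the smallest unital subalgebra of $\widetilde H$ containing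 $V_0,V_1,V_2$ and closed under the associative product and the Poisson bracket. *)

theory Defs
  imports Main "HOL-Library.Groups_Big_Fun"
begin

datatype gen = X nat | Y nat

text \<open>Ordering of generators used for normal-form monomials x^alpha y^beta:
  all x's (by increasing index) precede all y's (by increasing index).\<close>
fun gless :: "gen \<Rightarrow> gen \<Rightarrow> bool" where
  "gless (X i) (X j) = (i < j)"
| "gless (X i) (Y j) = True"
| "gless (Y i) (X j) = False"
| "gless (Y i) (Y j) = (i < j)"

text \<open>A monomial is a finite set of generators, read as the ordered product.
  A formal sum is its coefficient function.\<close>
type_synonym 'k fsum = "gen set \<Rightarrow> 'k"

text \<open>Sign of the product of monomials A and B (all generators odd):
  (-1)^(number of pairs a in A, b in B with b < a).\<close>
definition msign :: "gen set \<Rightarrow> gen set \<Rightarrow> 'k::comm_ring_1" where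
  "msign A B = (-1) ^ card {(a, b). a \<in> A \<and> b \<in> B \<and> gless b a}"

definition gmult :: "'k::comm_ring_1 fsum \<Rightarrow> 'k fsum \<Rightarrow> 'k fsum" where
  "gmult f g = (\<lambda>m. \<Sum>A\<in>Pow m. msign A (m - A) * f A * g (m - A))"

text \<open>Signs of left / right partial derivatives of a monomial m w.r.t. generator c in m.\<close>
definition lsign :: "gen \<Rightarrow> gen set \<Rightarrow> 'k::comm_ring_1" where
  "lsign c m = (-1) ^ card {h \<in> m. gless h c}"
definition rsign :: "gen \<Rightarrow> gen set \<Rightarrow> 'k::comm_ring_1" where
  "rsign c m = (-1) ^ card {h \<in> m. gless c h}"

text \<open>Coefficient at m of  sum over monomials of (f right-derivative c)(left-derivative d of g).\<close>
definition bterm :: "'k::comm_ring_1 fsum \<Rightarrow> 'k fsum \<Rightarrow> gen \<Rightarrow> gen \<Rightarrow> gen set \<Rightarrow> 'k" where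
  "bterm f g c d m = (\<Sum>A\<in>Pow m.
      if c \<notin> A \<and> d \<notin> m - A
      then rsign c (insert c A) * lsign d (insert d (m - A)) * msign A (m - A)
           * f (insert c A) * g (insert d (m - A))
      else 0)"

text \<open>Poisson bracket: {f,g} = sum_i (f d/dy_i)(d/dx_i g) + (f d/dx_i)(d/dy_i g),
  right derivatives on f, left derivatives on g. This is the unique extension of
  {y_i,x_j} = delta_ij, {x_i,x_j} = {y_i,y_j} = 0 by the super Leibniz rule.
  Each coefficient is a finite sum on the space Htilde (Sum_any sums over the support).\<close>
definition pbracket :: "'k::comm_ring_1 fsum \<Rightarrow> 'k fsum \<Rightarrow> 'k fsum" where
  "pbracket f g = (\<lambda>m. Sum_any (\<lambda>i. bterm f g (Y i) (X i) m + bterm f g (X i) (Y i) m))"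

definition gone :: "'k::comm_ring_1 fsum" where
  "gone = (\<lambda>m. if m = {} then 1 else 0)"

definition adm :: "gen set \<Rightarrow> bool" where
  "adm m \<longleftrightarrow> finite m \<and> (m = {} \<or> ((\<exists>j. Y j \<in> m) \<and> (\<forall>i. X i \<in> m \<longrightarrow> i < Max {j. Y j \<in> m})))"

definition Htilde :: "'k::comm_ring_1 fsum set" where
  "Htilde = {f. \<forall>m. f m \<noteq> 0 \<longrightarrow> adm m}"

text \<open>V_i = sum_k (prod_{n<k} x_{i+3n} x_{i+3n+1}) y_{i+3k}.\<close>
definition Vmono :: "nat \<Rightarrow> nat \<Rightarrow> gen set" where
  "Vmono i k = {X (i + 3 * n) | n. n < k} \<union> {X (i + 3 * n + 1) | n. n < k} \<union> {Y (i + 3 * k)}"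

definition V :: "nat \<Rightarrow> 'k::comm_ring_1 fsum" where
  "V i = (\<lambda>m. if \<exists>k. m = Vmono i k then 1 else 0)"

inductive_set Pois :: "'k::field fsum set" where
  one: "gone \<in> Pois"
| V0: "V 0 \<in> Pois"
| V1: "V 1 \<in> Pois"
| V2: "V 2 \<in> Pois"
| add: "f \<in> Pois \<Longrightarrow> g \<in> Pois \<Longrightarrow> (\<lambda>m. f m + g m) \<in> Pois"
| smult: "f \<in> Pois \<Longrightarrow> (\<lambda>m. c * f m) \<in> Pois"
| mult: "f \<in> Pois \<Longrightarrow> g \<in> Pois \<Longrightarrow> gmult f g \<in> Pois"
| brk: "f \<in> Pois \<Longrightarrow> g \<in> Pois \<Longrightarrow> pbracket f g \<in> Pois"

definition hom :: "nat \<Rightarrow> 'k::zero fsum \<Rightarrow> bool" where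
  "hom p f \<longleftrightarrow> (\<forall>m. f m \<noteq> 0 \<longrightarrow> card m mod 2 = p)"

section \<open>P[t]: polynomials in t with coefficients in P (F n = coefficient of t^n)\<close>

definition Pt :: "(nat \<Rightarrow> 'k::field fsum) set" where
  "Pt = {F. (\<forall>n. F n \<in> Pois) \<and> finite {n. F n \<noteq> (\<lambda>_. 0)}}"

definition tadd :: "(nat \<Rightarrow> 'k::field fsum) \<Rightarrow> (nat \<Rightarrow> 'k fsum) \<Rightarrow> (nat \<Rightarrow> 'k fsum)" where
  "tadd F G = (\<lambda>n m. F n m + G n m)"

definition tsmult :: "'k::field \<Rightarrow> (nat \<Rightarrow> 'k fsum) \<Rightarrow> (nat \<Rightarrow> 'k fsum)" where
  "tsmult c F = (\<lambda>n m. c * F n m)"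

definition tconst :: "'k::field fsum \<Rightarrow> (nat \<Rightarrow> 'k fsum)" where
  "tconst a = (\<lambda>n. if n = 0 then a else (\<lambda>_. 0))"

definition tvar :: "nat \<Rightarrow> 'k::field fsum" where
  "tvar = (\<lambda>n. if n = 1 then gone else (\<lambda>_. 0))"

definition tshift :: "(nat \<Rightarrow> 'k::field fsum) \<Rightarrow> (nat \<Rightarrow> 'k fsum)" where
  "tshift F = (\<lambda>n. if n = 0 then (\<lambda>_. 0) else F (n - 1))"

end

theory Submission
  imports Defs "HOL-Computational_Algebra.Formal_Power_Series"
begin

text \<open>
  The quantization is the normally ordered Clifford product with \<open>y\<^sub>i * x\<^sub>i + x\<^sub>i * y\<^sub>i = t\<close>: apply
  the product of the commuting operators \<open>1 + t E\<^sub>i\<close> to \<open>f \<otimes> g\<close>, where \<open>E\<^sub>i\<close> is the right derivative by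
  \<open>y\<^sub>i\<close> tensored with the left derivative by \<open>x\<^sub>i\<close>, and multiply out. Associativity holds because on
  triple tensors both bracketings become the product of all \<open>1 + t E\<^sub>i\<close> over the slots 12, 13 and 23.

  The point is that \<open>P[t]\<close> is closed under this product. Let \<open>B\<^sub>1\<close> be the coefficient of \<open>t\<close>. For two
  elements \<open>x\<^sup>A V\<^sub>n\<close> and \<open>x\<^sup>B V\<^sub>m\<close> with small exponents, \<open>B\<^sub>1\<close> is zero or again such an element up
  to sign, and it is \<open>0\<close>, \<open>1\<close> or \<open>1/2\<close> times their bracket; this is where characteristic 2 is excluded.
  Hence the elements \<open>v = x\<^sup>A V\<^sub>n\<close> lying in \<open>P\<close> are closed under \<open>B\<^sub>1\<close>. They are linear in the \<open>y\<^sub>i\<close>, so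
  \<open>v * g = v g + t B\<^sub>1(v, g)\<close> and \<open>B\<^sub>1(v, -)\<close> is a superderivation. Associativity gives
  \<open>(v w) * g = v * (w * g) - t B\<^sub>1(v, w) * g\<close>, and induction on the number of factors shows that the
  algebra they generate is closed under \<open>*\<close>, therefore under the bracket, and so it equals \<open>P\<close>.
\<close>

section \<open>Signs\<close>

lemma gless_irrefl [simp]: "\<not> gless a a"
  by (cases a) auto

lemma gless_linear: "a \<noteq> b \<Longrightarrow> gless a b \<longleftrightarrow> \<not> gless b a"
  by (cases a; cases b) auto

lemma minus_one_power_card_filter:
  "finite B \<Longrightarrow> (-1::'k::comm_ring_1) ^ card {b \<in> B. P b} = (\<Prod>b\<in>B. if P b then -1 else 1)"
  by (simp add: prod.If_cases Int_def)

lemma msign_prod: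
  assumes "finite A" "finite B"
  shows "(msign A B :: 'k::comm_ring_1) = (\<Prod>a\<in>A. \<Prod>b\<in>B. if gless b a then -1 else 1)"
proof -
  have "{(a, b). a \<in> A \<and> b \<in> B \<and> gless b a} = (SIGMA a:A. {b\<in>B. gless b a})"
    by auto
  then have "card {(a, b). a \<in> A \<and> b \<in> B \<and> gless b a} = (\<Sum>a\<in>A. card {b\<in>B. gless b a})"
    using assms by simp
  then have "(msign A B :: 'k) = (\<Prod>a\<in>A. (-1) ^ card {b\<in>B. gless b a})"
    by (simp add: msign_def power_sum)
  also have "\<dots> = (\<Prod>a\<in>A. \<Prod>b\<in>B. if gless b a then -1 else 1)"
    using assms by (intro prod.cong refl minus_one_power_card_filter)
  finally show ?thesis .
qed

lemma msign_empty [simp]: "msign {} B = 1" "msign A {} = 1"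
  by (auto simp: msign_def)

lemma msign_Un_left:
  "finite A \<Longrightarrow> finite A' \<Longrightarrow> finite B \<Longrightarrow> A \<inter> A' = {} \<Longrightarrow>
    msign (A \<union> A') B = msign A B * msign A' B"
  by (simp add: msign_prod prod.union_disjoint)

lemma msign_Un_right:
  "finite A \<Longrightarrow> finite B \<Longrightarrow> finite B' \<Longrightarrow> B \<inter> B' = {} \<Longrightarrow>
    msign A (B \<union> B') = msign A B * msign A B'"
  by (simp add: msign_prod prod.union_disjoint prod.distrib)

lemma msign_insert_left:
  "finite A \<Longrightarrow> finite B \<Longrightarrow> a \<notin> A \<Longrightarrow> msign (insert a A) B = msign {a} B * msign A B"
  by (simp add: msign_prod)

lemma msign_insert_right:
  "finite A \<Longrightarrow> finite B \<Longrightarrow> b \<notin> B \<Longrightarrow> msign A (insert b B) = msign A {b} * msign A B"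
  by (simp add: msign_prod prod.distrib)

lemma msign_square [simp]: "msign A B * msign A B = 1"
  by (simp add: msign_def flip: power_add mult_2)

lemma msign_square' [simp]: "msign A B * (msign A B * c) = c"
  by (simp flip: mult.assoc)

lemma minus_one_power_square [simp]: "(-1::'k::comm_ring_1) ^ n * ((-1) ^ n * c) = c"
  by (simp flip: mult.assoc power_add mult_2)

lemma msign_swap:
  assumes "finite A" "finite B" "A \<inter> B = {}"
  shows "msign A B * msign B A = ((-1) ^ (card A * card B) :: 'k::comm_ring_1)"
proof -
  have "(msign B A :: 'k) = (\<Prod>a\<in>A. \<Prod>b\<in>B. if gless a b then -1 else 1)"
    using assms by (simp add: msign_prod prod.swap[of _ A B])
  then have "msign A B * msign B A
      = (\<Prod>a\<in>A. \<Prod>b\<in>B. (if gless b a then -1 else 1) * (if gless a b then -1 else (1::'k)))"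
    using assms by (simp add: msign_prod prod.distrib)
  also have "\<dots> = (\<Prod>a\<in>A. \<Prod>b\<in>B. -1)"
    using assms by (intro prod.cong refl) (metis disjoint_iff gless_linear mult.right_neutral mult_1)
  also have "\<dots> = (-1) ^ (card A * card B)"
    by (simp add: mult.commute flip: power_mult)
  finally show ?thesis .
qed

lemma msign_swap_single:
  assumes "finite B" "c \<notin> B"
  shows "msign {c} B = ((-1) ^ card B * msign B {c} :: 'k::comm_ring_1)"
proof -
  have "msign {c} B * msign B {c} = ((-1) ^ card B :: 'k)"
    using msign_swap[of "{c}" B] assms by simp
  then have "msign {c} B * msign B {c} * msign B {c} = ((-1) ^ card B * msign B {c} :: 'k)"
    by simp
  then show ?thesis
    by (simp add: mult.assoc)
qed

lemma rsign_insert: "rsign c (insert c A) = msign A {c}"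
proof -
  have "{(a, b). a \<in> A \<and> b \<in> {c} \<and> gless b a} = (\<lambda>h. (h, c)) ` {h \<in> insert c A. gless c h}"
    by auto
  then show ?thesis
    by (simp add: rsign_def msign_def card_image inj_on_def)
qed

lemma lsign_insert: "lsign d (insert d B) = msign {d} B"
proof -
  have "{(a, b). a \<in> {d} \<and> b \<in> B \<and> gless b a} = (\<lambda>h. (d, h)) ` {h \<in> insert d B. gless h d}"
    by auto
  then show ?thesis
    by (simp add: lsign_def msign_def card_image inj_on_def)
qed

section \<open>Multiplication and derivatives on tensors\<close>

text \<open>Elements of tensor squares and cubes are represented by functions of two or three monomials.
  All operators below are given entrywise, so no convergence condition is needed before
  multiplying out.\<close>

definition mu :: "(gen set \<Rightarrow> gen set \<Rightarrow> 'k::comm_ring_1) \<Rightarrow> 'k fsum" where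
  "mu F = (\<lambda>m. \<Sum>A\<in>Pow m. msign A (m - A) * F A (m - A))"

text \<open>The rules for \<open>msign\<close> hold for finite sets, hence the guard on
  \<open>A\<close>, here and in \<open>LD\<close>.\<close>

definition RD :: "gen \<Rightarrow> 'k::comm_ring_1 fsum \<Rightarrow> 'k fsum" where
  "RD c f = (\<lambda>A. if finite A \<and> c \<notin> A then msign A {c} * f (insert c A) else 0)"

definition LD :: "gen \<Rightarrow> 'k::comm_ring_1 fsum \<Rightarrow> 'k fsum" where
  "LD c f = (\<lambda>A. if finite A \<and> c \<notin> A then msign {c} A * f (insert c A) else 0)"

lemma gmult_eq_mu: "gmult f g = mu (\<lambda>A B. f A * g B)"
  by (simp add: gmult_def mu_def mult.assoc)

lemma mu_infinite: "infinite m \<Longrightarrow> mu F m = 0"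
  by (simp add: mu_def)

lemma mu_zero [simp]: "mu (\<lambda>A B. 0) m = 0"
  by (simp add: mu_def)

lemma mu_add: "mu (\<lambda>A B. F A B + G A B) m = mu F m + mu G m"
  by (simp add: mu_def algebra_simps sum.distrib)

lemma mu_cmult: "mu (\<lambda>A B. c * F A B) m = c * mu F m"
  by (simp add: mu_def sum_distrib_left mult.left_commute)

lemma mu_sum: "mu (\<lambda>A B. \<Sum>i<n. G i A B) m = (\<Sum>i<(n::nat). mu (G i) m)"
  by (induction n) (simp_all add: mu_add)

lemma mu_cong:
  assumes "\<And>A B. finite m \<Longrightarrow> A \<inter> B = {} \<Longrightarrow> A \<union> B = m \<Longrightarrow> F A B = G A B"
  shows "mu F m = mu G m"
proof (cases "finite m")
  case True
  then show ?thesis unfolding mu_def using assms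
    by (intro sum.cong refl arg_cong2[where f="(*)"] assms) auto
qed (simp add: mu_infinite)

lemma sum_Pow_insert:
  fixes h :: "'a set \<Rightarrow> 'b::comm_monoid_add"
  assumes "finite M" "c \<notin> M"
  shows "(\<Sum>A\<in>Pow (insert c M). h A) = (\<Sum>A\<in>Pow M. h A + h (insert c A))"
proof -
  have "(\<Sum>A\<in>Pow (insert c M). h A) = (\<Sum>A\<in>Pow M. h A) + (\<Sum>A\<in>insert c ` Pow M. h A)"
    unfolding Pow_insert using assms by (intro sum.union_disjoint) auto
  also have "(\<Sum>A\<in>insert c ` Pow M. h A) = (\<Sum>A\<in>Pow M. h (insert c A))"
    using assms by (subst sum.reindex) (auto intro!: inj_onI simp: insert_ident subset_iff)
  finally show ?thesis by (simp add: sum.distrib)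
qed

text \<open>This is the super Leibniz rule on tensors: coming from the right, the odd derivative
  crosses \<open>B\<close> before it reaches \<open>A\<close>, whence the sign. Pairing
  \<open>A\<close> with \<open>insert c A\<close> records on which side \<open>c\<close>
  falls.\<close>

lemma RD_mu:
  fixes G :: "gen set \<Rightarrow> gen set \<Rightarrow> 'k::comm_ring_1"
  shows "RD c (mu G) M = mu (\<lambda>A B. (-1) ^ card B * RD c (\<lambda>a. G a B) A + RD c (G A) B) M"
proof (cases "finite M")
  case fin: True
  show ?thesis
  proof (cases "c \<in> M")
    case False
    have eq: "msign M {c} * (msign A (insert c M - A) * G A (insert c M - A)
           + msign (insert c A) (insert c M - insert c A) * G (insert c A) (insert c M - insert c A))
        = msign A (M - A) * ((-1) ^ card (M - A) * RD c (\<lambda>a. G a (M - A)) A + RD c (G A) (M - A))"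
      if "A \<subseteq> M" for A
    proof -
      define B where "B = M - A"
      have fAB: "finite A" "finite B" "c \<notin> A" "c \<notin> B" "A \<inter> B = {}"
        using that fin False by (auto simp: B_def finite_subset)
      have M: "M = A \<union> B" "insert c M - A = insert c B" "insert c M - insert c A = B"
        using that False by (auto simp: B_def)
      have "msign M {c} = (msign A {c} * msign B {c} :: 'k)"
        unfolding M using fAB by (simp add: msign_Un_left)
      with fAB show ?thesis unfolding M(2,3) B_def[symmetric]
        by (simp add: RD_def msign_insert_left[of A B c] msign_insert_right[of A B c] msign_swap_single[of B c] distrib_left mult_ac)
    qed
    have "RD c (mu G) M = msign M {c} * mu G (insert c M)"
      using fin False by (simp add: RD_def)
    also have "\<dots> = (\<Sum>A\<in>Pow M. msign M {c} * (msign A (insert c M - A) * G A (insert c M - A)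
           + msign (insert c A) (insert c M - insert c A) * G (insert c A) (insert c M - insert c A)))"
      unfolding mu_def sum_Pow_insert[OF fin False] by (rule sum_distrib_left)
    also have "\<dots> = mu (\<lambda>A B. (-1) ^ card B * RD c (\<lambda>a. G a B) A + RD c (G A) B) M"
      unfolding mu_def using eq by (intro sum.cong) auto
    finally show ?thesis .
  next
    case True
    then obtain N where N: "M = insert c N" "c \<notin> N" by (meson mk_disjoint_insert)
    then have finN: "finite N" using fin by simp
    let ?F = "\<lambda>A B. (-1) ^ card B * RD c (\<lambda>a. G a B) A + RD c (G A) B"
    \<comment> \<open>With \<open>c\<close> in \<open>M\<close> the left side is 0. On the right
      only entries with \<open>c\<close> in both factors occur, and the two ways of removing one
      \<open>c\<close> have opposite signs.\<close>
    have "msign A (M - A) * ?F A (M - A) + msign (insert c A) (M - insert c A) * ?F (insert c A) (M - insert c A) = 0"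
      if "A \<subseteq> N" for A
    proof -
      define B where "B = N - A"
      have fAB: "finite A" "finite B" "c \<notin> A" "c \<notin> B" "A \<inter> B = {}"
        using that finN N by (auto simp: B_def finite_subset)
      have M: "M - A = insert c B" "M - insert c A = B"
        using that N by (auto simp: B_def)
      show ?thesis unfolding M using fAB
        by (simp add: RD_def msign_insert_left[of A B c] msign_insert_right[of A B c] msign_swap_single[of B c] distrib_left mult_ac)
    qed
    then have "mu ?F M = 0"
      unfolding mu_def N(1) sum_Pow_insert[OF finN N(2)] by (intro sum.neutral) (auto simp: N(1))
    then show ?thesis using True by (simp add: RD_def)
  qed
qed (simp add: RD_def mu_infinite)

lemma LD_mu:
  fixes G :: "gen set \<Rightarrow> gen set \<Rightarrow> 'k::comm_ring_1"
  shows "LD c (mu G) M = mu (\<lambda>A B. LD c (\<lambda>a. G a B) A + (-1) ^ card A * LD c (G A) B) M"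
proof (cases "finite M")
  case fin: True
  show ?thesis
  proof (cases "c \<in> M")
    case False
    have eq: "msign {c} M * (msign A (insert c M - A) * G A (insert c M - A)
           + msign (insert c A) (insert c M - insert c A) * G (insert c A) (insert c M - insert c A))
        = msign A (M - A) * (LD c (\<lambda>a. G a (M - A)) A + (-1) ^ card A * LD c (G A) (M - A))"
      if "A \<subseteq> M" for A
    proof -
      define B where "B = M - A"
      have fAB: "finite A" "finite B" "c \<notin> A" "c \<notin> B" "A \<inter> B = {}"
        using that fin False by (auto simp: B_def finite_subset)
      have M: "M = A \<union> B" "insert c M - A = insert c B" "insert c M - insert c A = B"
        using that False by (auto simp: B_def)
      have "msign {c} M = (msign {c} A * msign {c} B :: 'k)"
        unfolding M using fAB by (simp add: msign_Un_right)
      with fAB show ?thesis unfolding M(2,3) B_def[symmetric]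
        by (simp add: LD_def msign_insert_left[of A B c] msign_insert_right[of A B c] msign_swap_single[of A c] distrib_left mult_ac)
    qed
    have "LD c (mu G) M = msign {c} M * mu G (insert c M)"
      using fin False by (simp add: LD_def)
    also have "\<dots> = (\<Sum>A\<in>Pow M. msign {c} M * (msign A (insert c M - A) * G A (insert c M - A)
           + msign (insert c A) (insert c M - insert c A) * G (insert c A) (insert c M - insert c A)))"
      unfolding mu_def sum_Pow_insert[OF fin False] by (rule sum_distrib_left)
    also have "\<dots> = mu (\<lambda>A B. LD c (\<lambda>a. G a B) A + (-1) ^ card A * LD c (G A) B) M"
      unfolding mu_def using eq by (intro sum.cong) auto
    finally show ?thesis .
  next
    case True
    then obtain N where N: "M = insert c N" "c \<notin> N" by (meson mk_disjoint_insert)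
    then have finN: "finite N" using fin by simp
    let ?F = "\<lambda>A B. LD c (\<lambda>a. G a B) A + (-1) ^ card A * LD c (G A) B"
    have "msign A (M - A) * ?F A (M - A) + msign (insert c A) (M - insert c A) * ?F (insert c A) (M - insert c A) = 0"
      if "A \<subseteq> N" for A
    proof -
      define B where "B = N - A"
      have fAB: "finite A" "finite B" "c \<notin> A" "c \<notin> B" "A \<inter> B = {}"
        using that finN N by (auto simp: B_def finite_subset)
      have M: "M - A = insert c B" "M - insert c A = B"
        using that N by (auto simp: B_def)
      show ?thesis unfolding M using fAB
        by (simp add: LD_def msign_insert_left[of A B c] msign_insert_right[of A B c] msign_swap_single[of A c] distrib_left mult_ac)
    qed
    then have "mu ?F M = 0"
      unfolding mu_def N(1) sum_Pow_insert[OF finN N(2)] by (intro sum.neutral) (auto simp: N(1))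
    then show ?thesis using True by (simp add: LD_def)
  qed
qed (simp add: LD_def mu_infinite)

text \<open>Both sides sum over the ordered partitions of \<open>m\<close> into three parts; by
  multiplicativity of \<open>msign\<close> the sign is the product of the signs of the three pairs
  of parts.\<close>

lemma mu_assoc:
  fixes F :: "gen set \<Rightarrow> gen set \<Rightarrow> gen set \<Rightarrow> 'k::comm_ring_1"
  shows "mu (\<lambda>M C. mu (\<lambda>A B. F A B C) M) m = mu (\<lambda>A M. mu (F A) M) m"
proof (cases "finite m")
  case fin: True
  let ?l = "\<lambda>(M, A). msign M (m - M) * (msign A (M - A) * F A (M - A) (m - M))"
  let ?r = "\<lambda>(A, B). msign A (m - A) * (msign B (m - A - B) * F A B (m - A - B))"
  have "mu (\<lambda>M C. mu (\<lambda>A B. F A B C) M) m = sum ?l (SIGMA M:Pow m. Pow M)"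
    using fin by (subst sum.Sigma[symmetric]) (auto simp: mu_def sum_distrib_left finite_subset)
  also have "\<dots> = sum ?r (SIGMA A:Pow m. Pow (m - A))"
  proof (rule sum.reindex_bij_witness[where i="\<lambda>(A, B). (A \<union> B, A)" and j="\<lambda>(M, A). (A, M - A)"],
      goal_cases)
    case (5 a)
    obtain M A where a: "a = (M, A)" "A \<subseteq> M" "M \<subseteq> m" using 5 by auto
    define B C where "B = M - A" and "C = m - M"
    have f: "finite A" "finite B" "finite C" "A \<inter> B = {}" "A \<inter> C = {}" "B \<inter> C = {}"
      using a fin by (auto simp: B_def C_def finite_subset)
    have e: "M = A \<union> B" "m - M = C" "m - A = B \<union> C" "m - A - B = C" "M - A = B"
      using a by (auto simp: B_def C_def)
    show ?case using f
      by (simp only: a(1) prod.case e(2,4,5))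
        (simp add: e(1,3) msign_Un_left msign_Un_right mult_ac)
  qed auto
  also have "\<dots> = mu (\<lambda>A M. mu (F A) M) m"
    using fin by (subst sum.Sigma[symmetric]) (auto simp: mu_def sum_distrib_left)
  finally show ?thesis .
qed (simp add: mu_infinite)

lemma gmult_assoc: "gmult (gmult f g) h = gmult f (gmult g h)"
proof
  fix m
  have "gmult (gmult f g) h m = mu (\<lambda>M C. mu (\<lambda>A B. f A * g B * h C) M) m"
    unfolding gmult_eq_mu by (simp add: mult.commute[of _ "h _"] flip: mu_cmult)
  also have "\<dots> = mu (\<lambda>A M. mu (\<lambda>B C. f A * (g B * h C)) M) m"
    by (subst mu_assoc) (simp add: mult.assoc)
  also have "\<dots> = gmult f (gmult g h) m"
    unfolding gmult_eq_mu by (simp add: mu_cmult)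
  finally show "gmult (gmult f g) h m = gmult f (gmult g h) m" .
qed

section \<open>The star product\<close>

definition E :: "nat \<Rightarrow> (gen set \<Rightarrow> gen set \<Rightarrow> 'k::comm_ring_1) \<Rightarrow> gen set \<Rightarrow> gen set \<Rightarrow> 'k" where
  "E i F = (\<lambda>A B. RD (Y i) (\<lambda>a. LD (X i) (F a) B) A)"

section \<open>Contractions between two slots of a triple tensor\<close>

definition E12 :: "nat \<Rightarrow> (gen set \<Rightarrow> gen set \<Rightarrow> gen set \<Rightarrow> 'k::comm_ring_1) \<Rightarrow> gen set \<Rightarrow> gen set \<Rightarrow> gen set \<Rightarrow> 'k" where
  "E12 i F = (\<lambda>A B C. E i (\<lambda>a b. F a b C) A B)"

definition E23 :: "nat \<Rightarrow> (gen set \<Rightarrow> gen set \<Rightarrow> gen set \<Rightarrow> 'k::comm_ring_1) \<Rightarrow> gen set \<Rightarrow> gen set \<Rightarrow> gen set \<Rightarrow> 'k" where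
  "E23 i F = (\<lambda>A B C. E i (F A) B C)"

text \<open>The sign is the cost of carrying one odd derivative across the middle factor.
  \<open>RD_mu\<close> and \<open>LD_mu\<close> both produce it, so this one operator serves both
  bracketings.\<close>

definition E13 :: "nat \<Rightarrow> (gen set \<Rightarrow> gen set \<Rightarrow> gen set \<Rightarrow> 'k::comm_ring_1) \<Rightarrow> gen set \<Rightarrow> gen set \<Rightarrow> gen set \<Rightarrow> 'k" where
  "E13 i F = (\<lambda>A B C. (-1) ^ card B * E i (\<lambda>a. F a B) A C)"

lemma E_apply:
  "E i F A B = (if finite A \<and> finite B \<and> Y i \<notin> A \<and> X i \<notin> B
     then msign A {Y i} * (msign {X i} B * F (insert (Y i) A) (insert (X i) B)) else 0)"
  by (simp add: E_def RD_def LD_def)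

lemma E_add: "E i (\<lambda>A B. F A B + G A B) A B = E i F A B + E i G A B"
  by (simp add: E_apply algebra_simps)

lemma E_cmult: "E i (\<lambda>A B. c * F A B) A B = c * E i F A B"
  by (simp add: E_apply algebra_simps)

lemma E_tensor: "E i (\<lambda>A B. f A * g B) A B = RD (Y i) f A * LD (X i) g B"
  by (simp add: E_apply RD_def LD_def)

lemma msign_single: "msign {a} {b} = (if gless b a then -1 else 1)"
  by (simp add: msign_prod)

text \<open>The two right derivatives in slot 1 anticommute. The compensating sign comes from
  \<open>(-1) ^ card B\<close> in \<open>E13\<close>, since \<open>E12\<close> changes the parity of
  the middle factor. \<open>E13_E23_commute\<close> works the same way in slot 3; in
  \<open>E12_E23_commute\<close> a left and a right derivative meet in slot 2, and these
  commute.\<close>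

lemma E12_E13_commute: "E12 i (E13 j F) = E13 j (E12 i F)"
proof (intro ext)
  fix A B C
  show "E12 i (E13 j F) A B C = E13 j (E12 i F) A B C"
  proof (cases "i \<noteq> j \<and> finite A \<and> finite B \<and> finite C \<and> Y i \<notin> A \<and> Y j \<notin> A \<and> X i \<notin> B \<and> X j \<notin> C")
    case True
    then show ?thesis
      by (simp add: E12_def E13_def E_apply msign_insert_left[of A "{Y i}"] msign_insert_left[of A "{Y j}"]
          insert_commute[of "Y i" "Y j"] msign_single mult_ac)
  next
    case False
    then show ?thesis
      by (auto simp: E12_def E13_def E_apply)
  qed
qed

lemma E12_E23_commute: "E12 i (E23 j F) = E23 j (E12 i F)"
proof (intro ext)
  fix A B C
  show "E12 i (E23 j F) A B C = E23 j (E12 i F) A B C"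
  proof (cases "finite A \<and> finite B \<and> finite C \<and> Y i \<notin> A \<and> Y j \<notin> B \<and> X i \<notin> B \<and> X j \<notin> C")
    case True
    then show ?thesis
      by (simp add: E12_def E23_def E_apply msign_insert_left[of B "{Y j}"] msign_insert_right[of "{X i}" B]
          insert_commute[of "X i" "Y j"] msign_single mult_ac)
  next
    case False
    then show ?thesis
      by (auto simp: E12_def E23_def E_apply)
  qed
qed

lemma E13_E23_commute: "E13 i (E23 j F) = E23 j (E13 i F)"
proof (intro ext)
  fix A B C
  show "E13 i (E23 j F) A B C = E23 j (E13 i F) A B C"
  proof (cases "i \<noteq> j \<and> finite A \<and> finite B \<and> finite C \<and> Y i \<notin> A \<and> Y j \<notin> B \<and> X i \<notin> C \<and> X j \<notin> C")
    case True
    then show ?thesis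
      by (simp add: E13_def E23_def E_apply msign_insert_right[of "{X i}" C] msign_insert_right[of "{X j}" C]
          insert_commute[of "X i" "X j"] msign_single mult_ac)
  next
    case False
    then show ?thesis
      by (auto simp: E13_def E23_def E_apply)
  qed
qed

text \<open>The same \<open>y_i\<close> in slot 1, or the same \<open>x_i\<close> in slot 3, would
  be removed twice. Hence a product such as \<open>(1 + t E12)(1 + t E13)\<close> at one index has
  no quadratic term.\<close>

lemma E12_E13_same: "E12 i (E13 i F) A B C = 0"
  and E13_E23_same: "E13 i (E23 i F) A B C = 0"
  by (simp_all add: E12_def E13_def E23_def E_apply)

text \<open>The \<open>y_i\<close> to be contracted with slot 3 comes from either factor of the
  product in the first argument; dually for \<open>x_i\<close> in \<open>E_mu23\<close>.\<close>

lemma E_mu12: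
  "E i (\<lambda>M C. mu (\<lambda>A B. F A B C) M) M C = mu (\<lambda>A B. E13 i F A B C + E23 i F A B C) M"
proof -
  have "LD (X i) (\<lambda>C. mu (\<lambda>A B. F A B C) M) C = mu (\<lambda>A B. LD (X i) (F A B) C) M" for M
    by (cases "finite C \<and> X i \<notin> C") (auto simp: LD_def mu_cmult)
  then show ?thesis
    by (simp add: E_def E13_def E23_def RD_mu)
qed

lemma E_mu23:
  "E i (\<lambda>A M. mu (F A) M) A M = mu (\<lambda>B C. E12 i F A B C + E13 i F A B C) M"
proof -
  have "E i (\<lambda>A M. mu (F A) M) A M
      = RD (Y i) (\<lambda>a. mu (\<lambda>B C. LD (X i) (\<lambda>b. F a b C) B + (-1) ^ card B * LD (X i) (F a B) C) M) A"
    by (simp add: E_def LD_mu)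
  also have "\<dots> = mu (\<lambda>B C. RD (Y i) (\<lambda>a. LD (X i) (\<lambda>b. F a b C) B + (-1) ^ card B * LD (X i) (F a B) C) A) M"
    by (cases "finite A \<and> Y i \<notin> A") (auto simp: RD_def mu_cmult)
  also have "\<dots> = mu (\<lambda>B C. E12 i F A B C + E13 i F A B C) M"
    by (intro mu_cong) (simp add: E12_def E13_def E_def RD_def algebra_simps)
  finally show ?thesis .
qed

section \<open>The product of the operators \<open>1 + t E_i\<close> over \<open>i < n\<close> and
  its associativity\<close>

primrec PP :: "'k::comm_ring_1 \<Rightarrow> nat \<Rightarrow> (gen set \<Rightarrow> gen set \<Rightarrow> 'k) \<Rightarrow> gen set \<Rightarrow> gen set \<Rightarrow> 'k" where
  "PP t 0 F = F"
| "PP t (Suc n) F = (\<lambda>A B. PP t n F A B + t * E n (PP t n F) A B)"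

lemma PP_add: "PP t n (\<lambda>A B. F A B + G A B) = (\<lambda>A B. PP t n F A B + PP t n G A B)"
  by (induction n) (simp_all add: E_add algebra_simps)

lemma PP_cmult: "PP t n (\<lambda>A B. c * F A B) = (\<lambda>A B. c * PP t n F A B)"
  by (induction n) (simp_all add: E_cmult algebra_simps)

text \<open>Expand the product of the factors \<open>1 + t E_i\<close>: \<open>S\<close> is the set
  of indices contracted in a nonzero summand.\<close>

lemma PP_support:
  assumes "PP t n F A B \<noteq> 0"
  obtains S where "S \<subseteq> {..<n}" "A \<inter> Y ` S = {}" "B \<inter> X ` S = {}" "F (A \<union> Y ` S) (B \<union> X ` S) \<noteq> 0"
  using assms
proof (induction n arbitrary: A B thesis)
  case 0
  then show ?case by (force intro: "0.prems"(1)[of "{}"])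
next
  case (Suc n)
  show ?case
  proof (cases "PP t n F A B = 0")
    case True
    then have "E n (PP t n F) A B \<noteq> 0" using Suc.prems(2) by auto
    then have n: "Y n \<notin> A" "X n \<notin> B" "PP t n F (insert (Y n) A) (insert (X n) B) \<noteq> 0"
      by (auto simp: E_apply split: if_splits)
    from Suc.IH[OF _ n(3)] obtain S where S: "S \<subseteq> {..<n}" "insert (Y n) A \<inter> Y ` S = {}"
      "insert (X n) B \<inter> X ` S = {}" "F (insert (Y n) A \<union> Y ` S) (insert (X n) B \<union> X ` S) \<noteq> 0" by metis
    show ?thesis
      by (rule Suc.prems(1)[of "insert n S"]) (use S n in auto)
  next
    case False
    from Suc.IH[OF _ False] obtain S where "S \<subseteq> {..<n}" "A \<inter> Y ` S = {}"
      "B \<inter> X ` S = {}" "F (A \<union> Y ` S) (B \<union> X ` S) \<noteq> 0" by metis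
    then show ?thesis
      by (intro Suc.prems(1)[of S]) auto
  qed
qed

lemma PP_cong:
  assumes "\<And>S. S \<subseteq> {..<n} \<Longrightarrow> F (A \<union> Y ` S) (B \<union> X ` S) = G (A \<union> Y ` S) (B \<union> X ` S)"
  shows "PP t n F A B = PP t n G A B"
proof (rule ccontr)
  assume "PP t n F A B \<noteq> PP t n G A B"
  then have "PP t n (\<lambda>A B. F A B + (-1) * G A B) A B \<noteq> 0"
    unfolding PP_add PP_cmult by simp
  then show False
    using assms by (elim PP_support) auto
qed

definition starN :: "'k::comm_ring_1 \<Rightarrow> nat \<Rightarrow> 'k fsum \<Rightarrow> 'k fsum \<Rightarrow> 'k fsum" where
  "starN t n f g = mu (PP t n (\<lambda>A B. f A * g B))"

primrec IT :: "(nat \<Rightarrow> 'a \<Rightarrow> 'a) \<Rightarrow> nat \<Rightarrow> 'a \<Rightarrow> 'a" where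
  "IT T 0 F = F"
| "IT T (Suc n) F = T n (IT T n F)"

lemma IT_commute:
  assumes "\<And>i j F. a i (b j F) = b j (a i F)"
  shows "IT a n (b j F) = b j (IT a n F)"
  by (induction n) (simp_all add: assms)

text \<open>Products of two commuting families are interleaved into one product; this regroups the
  three pairs of slots in either order.\<close>

lemma IT_IT:
  assumes "\<And>i j F. a i (b j F) = b j (a i F)"
  shows "IT a n (IT b n F) = IT (\<lambda>i F. a i (b i F)) n F"
  by (induction n) (simp_all add: IT_commute[of a b, OF assms])

theorem starN_assoc:
  fixes f g h :: "'k::comm_ring_1 fsum"
  shows "starN t n (starN t n f g) h = starN t n f (starN t n g h)"
proof
  fix m
  define plus :: "((gen set \<Rightarrow> gen set \<Rightarrow> gen set \<Rightarrow> 'k) \<Rightarrow> gen set \<Rightarrow> gen set \<Rightarrow> gen set \<Rightarrow> 'k) \<Rightarrow> _"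
    where "plus T F = (\<lambda>A B C. F A B C + t * T F A B C)" for T F
  let ?T12 = "\<lambda>i. plus (E12 i)" and ?T13 = "\<lambda>i. plus (E13 i)" and ?T23 = "\<lambda>i. plus (E23 i)"
  have lin: "E12 i (plus T F) = (\<lambda>A B C. E12 i F A B C + t * E12 i (T F) A B C)"
    "E13 i (plus T F) = (\<lambda>A B C. E13 i F A B C + t * E13 i (T F) A B C)"
    "E23 i (plus T F) = (\<lambda>A B C. E23 i F A B C + t * E23 i (T F) A B C)" for i T F
    by (simp_all add: plus_def E12_def E13_def E23_def E_add E_cmult algebra_simps)
  have c1213: "?T12 i (?T13 j F) = ?T13 j (?T12 i F)" for i j F
    unfolding plus_def[of _ "plus _ _"] lin E12_E13_commute by (simp add: plus_def algebra_simps)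
  have c1223: "?T12 i (?T23 j F) = ?T23 j (?T12 i F)" for i j F
    unfolding plus_def[of _ "plus _ _"] lin E12_E23_commute by (simp add: plus_def algebra_simps)
  have c1323: "?T13 i (?T23 j F) = ?T23 j (?T13 i F)" for i j F
    unfolding plus_def[of _ "plus _ _"] lin E13_E23_commute by (simp add: plus_def algebra_simps)
  \<comment> \<open>\<open>PP\<close> moves past the inner multiplication: by \<open>E_mu12\<close>
    a contraction of the product is \<open>E13 + E23\<close>, and \<open>1 + t (E13 + E23)\<close>
    factors because the mixed term vanishes.\<close>
  have mu12: "PP t n (\<lambda>M C. mu (\<lambda>A B. F A B C) M)
      = (\<lambda>M C. mu (\<lambda>A B. IT (\<lambda>i F. ?T13 i (?T23 i F)) n F A B C) M)" for F n
  proof (induction n)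
    case (Suc n)
    have "?T13 n (?T23 n G) = (\<lambda>A B C. G A B C + t * (E13 n G A B C + E23 n G A B C))" for G
      unfolding plus_def[of _ "plus _ _"] lin E13_E23_same by (simp add: plus_def algebra_simps)
    then show ?case by (simp add: Suc E_mu12 mu_add mu_cmult)
  qed simp
  have mu23: "PP t n (\<lambda>A M. mu (F A) M)
      = (\<lambda>A M. mu (IT (\<lambda>i F. ?T12 i (?T13 i F)) n F A) M)" for F n
  proof (induction n)
    case (Suc n)
    have "?T12 n (?T13 n G) = (\<lambda>A B C. G A B C + t * (E12 n G A B C + E13 n G A B C))" for G
      unfolding plus_def[of _ "plus _ _"] lin E12_E13_same by (simp add: plus_def algebra_simps)
    then show ?case by (simp add: Suc E_mu23 mu_add mu_cmult)
  qed simp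
  have it12: "IT ?T12 n F = (\<lambda>A B C. PP t n (\<lambda>a b. F a b C) A B)" for F n
    by (induction n) (simp_all add: plus_def E12_def)
  have it23: "IT ?T23 n F = (\<lambda>A B C. PP t n (F A) B C)" for F n
    by (induction n) (simp_all add: plus_def E23_def)
  let ?F = "\<lambda>A B C. f A * g B * h C"
  have "(\<lambda>M C. starN t n f g M * h C) = (\<lambda>M C. mu (\<lambda>A B. IT ?T12 n ?F A B C) M)"
    by (simp add: starN_def it12 PP_cmult mu_cmult mult.commute[of _ "h _"])
  then have "starN t n (starN t n f g) h m
      = mu (\<lambda>M C. mu (\<lambda>A B. IT (\<lambda>i F. ?T13 i (?T23 i F)) n (IT ?T12 n ?F) A B C) M) m"
    by (simp add: starN_def[of _ _ _ h] mu12)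
  also have "\<dots> = mu (\<lambda>A M. mu (IT (\<lambda>i F. ?T13 i (?T23 i F)) n (IT ?T12 n ?F) A) M) m"
    by (rule mu_assoc)
  \<comment> \<open>All three families now act on the same triple tensor; only their grouping
    differs between the two bracketings.\<close>
  also have "IT (\<lambda>i F. ?T13 i (?T23 i F)) n (IT ?T12 n ?F) = IT (\<lambda>i F. ?T12 i (?T13 i (?T23 i F))) n ?F"
    by (subst IT_IT) (simp_all add: c1213 c1223)
  also have "\<dots> = IT (\<lambda>i F. ?T12 i (?T13 i F)) n (IT ?T23 n ?F)"
    by (subst IT_IT) (simp_all add: c1223 c1323)
  also have "mu (\<lambda>A M. mu (IT (\<lambda>i F. ?T12 i (?T13 i F)) n (IT ?T23 n ?F) A) M) m
      = mu (PP t n (\<lambda>A M. mu (IT ?T23 n ?F A) M)) m"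
    by (simp add: mu23)
  also have "(\<lambda>A M. mu (IT ?T23 n ?F A) M) = (\<lambda>A M. f A * starN t n g h M)"
    by (simp add: starN_def it23 PP_cmult mu_cmult mult.assoc)
  also have "mu (PP t n (\<lambda>A M. f A * starN t n g h M)) m = starN t n f (starN t n g h) m"
    by (simp add: starN_def[of _ _ f])
  finally show "starN t n (starN t n f g) h m = starN t n f (starN t n g h) m" .
qed

section \<open>From truncated products to the product on \<open>Htilde\<close>\<close>

definition bnd :: "gen set \<Rightarrow> nat" where
  "bnd m = Max (insert 0 {j. Y j \<in> m})"

lemma finite_Y_index: "finite m \<Longrightarrow> finite {j. Y j \<in> m}"
  by (rule finite_subset[of _ "(\<lambda>g. case g of X i \<Rightarrow> i | Y i \<Rightarrow> i) ` m"]) (force simp: image_iff)+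

lemma bnd_le_iff: "finite m \<Longrightarrow> bnd m \<le> n \<longleftrightarrow> (\<forall>j. Y j \<in> m \<longrightarrow> j \<le> n)"
  by (simp add: bnd_def finite_Y_index)

text \<open>Asking for some larger \<open>y\<close> index instead of the maximum also covers the
  empty monomial and is easy to check on unions.\<close>

lemma adm_iff: "adm m \<longleftrightarrow> finite m \<and> (\<forall>i. X i \<in> m \<longrightarrow> (\<exists>j>i. Y j \<in> m))"
proof (cases "finite m \<and> (\<exists>j. Y j \<in> m)")
  case True
  then have "i < Max {j. Y j \<in> m} \<longleftrightarrow> (\<exists>j>i. Y j \<in> m)" for i
    by (subst Max_gr_iff) (auto simp: finite_Y_index)
  with True show ?thesis by (auto simp: adm_def)
next
  case False
  moreover have "m = {} \<longleftrightarrow> (\<forall>i. X i \<notin> m)" if "\<forall>j. Y j \<notin> m"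
    using that by (metis all_not_in_conv gen.exhaust)
  ultimately show ?thesis
    by (auto simp: adm_def)
qed

text \<open>The infinite product is evaluated entrywise, each coefficient with its own truncation.
  For a right factor in \<open>Htilde\<close> a longer truncation gives the same value, see
  \<open>starN_eq_star\<close>.\<close>

definition star :: "'k::comm_ring_1 \<Rightarrow> 'k fsum \<Rightarrow> 'k fsum \<Rightarrow> 'k fsum" where
  "star t f g = (\<lambda>m. starN t (bnd m) f g m)"

lemma starN_infinite: "infinite m \<Longrightarrow> starN t n f g m = 0"
  by (simp add: starN_def mu_infinite)

lemma Htilde_adm: "f \<in> Htilde \<Longrightarrow> f m \<noteq> 0 \<Longrightarrow> adm m"
  by (auto simp: Htilde_def)

text \<open>Contracting the index \<open>n\<close> needs \<open>x_n\<close> in a monomial of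
  \<open>g\<close>. Admissibility then supplies some \<open>y_j\<close> with \<open>j > n\<close>,
  which survives in \<open>m\<close>, so \<open>n < bnd m\<close>.\<close>

lemma starN_eq_star:
  assumes "g \<in> Htilde" "finite m" "bnd m \<le> n"
  shows "starN t n f g m = star t f g m"
  using assms(3)
proof (induction n rule: dec_induct)
  case base
  then show ?case by (simp add: star_def)
next
  case (step n)
  have "PP t (Suc n) (\<lambda>A B. f A * g B) A B = PP t n (\<lambda>A B. f A * g B) A B"
    if AB: "A \<union> B = m" for A B
  proof -
    have "PP t n (\<lambda>A B. f A * g B) (insert (Y n) A) (insert (X n) B) = 0"
    proof (rule ccontr)
      assume "\<not> ?thesis"
      then obtain S where "f (insert (Y n) A \<union> Y ` S) * g (insert (X n) B \<union> X ` S) \<noteq> 0"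
        by (rule PP_support)
      then have "g (insert (X n) B \<union> X ` S) \<noteq> 0" by auto
      then have "adm (insert (X n) B \<union> X ` S)" using assms(1) by (rule Htilde_adm[rotated])
      then obtain j where "j > n" "Y j \<in> B" by (auto simp: adm_iff)
      then have "bnd m > n"
        using AB assms(2) by (meson UnCI bnd_le_iff leD not_le)
      then show False using step by simp
    qed
    then show ?thesis by (simp add: E_apply)
  qed
  then have "starN t (Suc n) f g m = starN t n f g m"
    unfolding starN_def by (intro mu_cong) metis
  then show ?case using step by simp
qed

lemma star_support:
  assumes "star t f g m \<noteq> 0"
  obtains A B S where "finite m" "A \<union> B = m" "A \<inter> B = {}" "finite S" "A \<inter> Y ` S = {}" "B \<inter> X ` S = {}"
    "f (A \<union> Y ` S) \<noteq> 0" "g (B \<union> X ` S) \<noteq> 0"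
proof -
  have "finite m" using assms by (metis star_def starN_infinite)
  have "\<exists>A\<in>Pow m. PP t (bnd m) (\<lambda>A B. f A * g B) A (m - A) \<noteq> 0"
    using assms unfolding star_def starN_def mu_def by (metis (no_types, lifting) mult_zero_right sum.neutral)
  then obtain A where A: "A \<subseteq> m" "PP t (bnd m) (\<lambda>A B. f A * g B) A (m - A) \<noteq> 0" by auto
  from A(2) show thesis
  proof (rule PP_support)
    fix S assume "S \<subseteq> {..<bnd m}" "A \<inter> Y ` S = {}" "(m - A) \<inter> X ` S = {}"
      "f (A \<union> Y ` S) * g (m - A \<union> X ` S) \<noteq> 0"
    with A(1) \<open>finite m\<close> show thesis
      by (intro that[of A "m - A" S]) (auto simp: finite_subset)
  qed
qed

text \<open>An \<open>x_i\<close> from the left monomial has a larger \<open>y_j\<close> there. If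
  that \<open>y_j\<close> was contracted, then \<open>x_j\<close> stood in the right monomial, which
  in turn supplies a still larger \<open>y\<close> that survives.\<close>

lemma star_Htilde:
  assumes "f \<in> Htilde" "g \<in> Htilde"
  shows "star t f g \<in> Htilde"
  unfolding Htilde_def
proof safe
  fix m assume "star t f g m \<noteq> 0"
  then obtain A B S where m: "finite m" "A \<union> B = m" "f (A \<union> Y ` S) \<noteq> 0" "g (B \<union> X ` S) \<noteq> 0"
    by (elim star_support)
  then have "adm (A \<union> Y ` S)" "adm (B \<union> X ` S)"
    using assms Htilde_adm by blast+
  then have YA: "\<And>i. X i \<in> A \<Longrightarrow> \<exists>j>i. Y j \<in> A \<or> j \<in> S" 
    and YB: "\<And>i. X i \<in> B \<or> i \<in> S \<Longrightarrow> \<exists>j>i. Y j \<in> B"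
    by (auto simp: adm_iff)
  show "adm m"
    unfolding adm_iff
  proof (intro conjI allI impI)
    fix i assume "X i \<in> m"
    with m(2) consider "X i \<in> A" | "X i \<in> B" by blast
    then show "\<exists>j>i. Y j \<in> m"
    proof cases
      case 1
      from YA[OF this] obtain j where "j > i" "Y j \<in> A \<or> j \<in> S" by blast
      then show ?thesis using YB[of j] m(2) by (metis UnCI order.strict_trans)
    next
      case 2
      then show ?thesis using YB[of i] m(2) by blast
    qed
  qed (rule m(1))
qed

text \<open>At a fixed \<open>m\<close> one truncation \<open>n = bnd m\<close> serves all products:
  the inner ones are evaluated only at submonomials of \<open>m\<close> enlarged by contracted
  generators of index below \<open>n\<close>, and their \<open>bnd\<close> is at most
  \<open>n\<close>.\<close>

theorem star_assoc:
  assumes "g \<in> Htilde" "h \<in> Htilde"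
  shows "star t (star t f g) h = star t f (star t g h)"
proof
  fix m
  show "star t (star t f g) h m = star t f (star t g h) m"
  proof (cases "finite m")
    case True
    define n where "n = bnd m"
    have Yn: "j \<le> n" if "Y j \<in> m" for j
      using that True bnd_le_iff[of m n] by (auto simp: n_def)
    have "star t (star t f g) h m = starN t n (starN t n f g) h m"
      unfolding star_def[of _ _ h] n_def[symmetric] unfolding starN_def[of _ _ _ h]
    proof (intro mu_cong PP_cong)
      fix A B :: "gen set" and S assume "finite m" "A \<union> B = m" and S: "S \<subseteq> {..<n}"
      then have "finite (A \<union> Y ` S)" by (auto simp: finite_subset)
      moreover from this have "bnd (A \<union> Y ` S) \<le> n"
        using S Yn \<open>A \<union> B = m\<close> by (auto simp: bnd_le_iff)
      ultimately have "starN t n f g (A \<union> Y ` S) = star t f g (A \<union> Y ` S)"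
        by (rule starN_eq_star[OF assms(1)])
      then show "star t f g (A \<union> Y ` S) * h (B \<union> X ` S) = starN t n f g (A \<union> Y ` S) * h (B \<union> X ` S)"
        by simp
    qed
    also have "\<dots> = starN t n f (starN t n g h) m"
      by (simp add: starN_assoc)
    also have "\<dots> = star t f (star t g h) m"
      unfolding star_def[of _ f] n_def[symmetric] unfolding starN_def[of _ _ f]
    proof (intro mu_cong PP_cong)
      fix A B :: "gen set" and S assume "finite m" "A \<union> B = m" and S: "S \<subseteq> {..<n}"
      then have "finite (B \<union> X ` S)" by (auto simp: finite_subset)
      moreover from this have "bnd (B \<union> X ` S) \<le> n"
        using Yn \<open>A \<union> B = m\<close> by (auto simp: bnd_le_iff)
      ultimately have "starN t n g h (B \<union> X ` S) = star t g h (B \<union> X ` S)"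
        by (rule starN_eq_star[OF assms(2)])
      then show "f (A \<union> Y ` S) * starN t n g h (B \<union> X ` S) = f (A \<union> Y ` S) * star t g h (B \<union> X ` S)"
        by simp
    qed
    finally show ?thesis .
  qed (simp add: star_def starN_infinite)
qed

lemma star_add_left: "star t (\<lambda>m. f m + f' m) g = (\<lambda>m. star t f g m + star t f' g m)"
  by (simp add: star_def starN_def distrib_right PP_add mu_add)

lemma star_add_right: "star t f (\<lambda>m. g m + g' m) = (\<lambda>m. star t f g m + star t f g' m)"
  by (simp add: star_def starN_def distrib_left PP_add mu_add)

lemma star_cmult_left: "star t (\<lambda>m. c * f m) g = (\<lambda>m. c * star t f g m)"
  by (simp add: star_def starN_def mult.assoc PP_cmult mu_cmult)

lemma star_cmult_right: "star t f (\<lambda>m. c * g m) = (\<lambda>m. c * star t f g m)"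
  by (simp add: star_def starN_def mult.left_commute[of _ c] PP_cmult mu_cmult)

section \<open>Special values, the unit and parity\<close>

lemma PP_trivial: "(\<And>i. E i F = (\<lambda>A B. 0)) \<Longrightarrow> PP t n F = F"
  by (induction n) simp_all

lemma PP_linear:
  assumes "\<And>i j. E j (E i F) = (\<lambda>A B. 0)"
  shows "PP t n F = (\<lambda>A B. F A B + t * (\<Sum>i<n. E i F A B))"
proof (induction n)
  case (Suc n)
  have sum: "E n (\<lambda>A B. \<Sum>i<k. E i F A B) = (\<lambda>A B. 0)" for k
    by (induction k) (simp_all add: E_add assms, simp add: E_apply cong: if_cong)
  show ?case
    unfolding PP.simps Suc E_add E_cmult sum by (simp add: algebra_simps)
qed simp

lemma gmult_gone_left:
  assumes "finite m" shows "gmult gone f m = f m"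
proof -
  have "gmult gone f m = (\<Sum>A\<in>Pow m. if A = {} then f m else 0)"
    unfolding gmult_def by (intro sum.cong) (auto simp: gone_def)
  then show ?thesis using assms by simp
qed

lemma gmult_gone_right:
  assumes "finite m" shows "gmult f gone m = f m"
proof -
  have "gmult f gone m = (\<Sum>A\<in>Pow m. if A = m then f m else 0)"
    unfolding gmult_def by (intro sum.cong) (auto simp: gone_def)
  then show ?thesis using assms by simp
qed

lemma Htilde_infinite: "f \<in> Htilde \<Longrightarrow> infinite m \<Longrightarrow> f m = 0"
  using Htilde_adm adm_def by blast

lemma star_gone_right: "f \<in> Htilde \<Longrightarrow> star t f gone = f"
proof
  fix m assume f: "f \<in> Htilde"
  have "PP t n (\<lambda>A B. f A * gone B) = (\<lambda>A B. f A * gone B)" for n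
    by (rule PP_trivial) (auto simp: E_apply gone_def fun_eq_iff)
  then show "star t f gone m = f m"
    using gmult_gone_right[of m f] Htilde_infinite[OF f, of m]
    by (cases "finite m") (simp_all add: star_def starN_def gmult_eq_mu mu_infinite)
qed

lemma star_gone_left: "f \<in> Htilde \<Longrightarrow> star t gone f = f"
proof
  fix m assume f: "f \<in> Htilde"
  have "PP t n (\<lambda>A B. gone A * f B) = (\<lambda>A B. gone A * f B)" for n
    by (rule PP_trivial) (auto simp: E_apply gone_def fun_eq_iff)
  then show "star t gone f m = f m"
    using gmult_gone_left[of m f] Htilde_infinite[OF f, of m]
    by (cases "finite m") (simp_all add: star_def starN_def gmult_eq_mu mu_infinite)
qed

text \<open>Every contraction removes one generator from each factor, so the total degree drops by
  the even number \<open>2 * card S\<close>.\<close>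

lemma star_hom:
  assumes "hom p f" "hom q g"
  shows "hom ((p + q) mod 2) (star t f g)"
  unfolding hom_def
proof safe
  fix m assume "star t f g m \<noteq> 0"
  then obtain A B S where m: "finite m" "A \<union> B = m" "A \<inter> B = {}" "finite S" "A \<inter> Y ` S = {}" "B \<inter> X ` S = {}"
    "f (A \<union> Y ` S) \<noteq> 0" "g (B \<union> X ` S) \<noteq> 0" by (elim star_support)
  have fin: "finite A" "finite B" using m by auto
  have "card (A \<union> Y ` S) mod 2 = p" "card (B \<union> X ` S) mod 2 = q"
    using assms m by (auto simp: hom_def)
  moreover have "card (A \<union> Y ` S) = card A + card S" "card (B \<union> X ` S) = card B + card S"
    using m fin by (auto simp: card_Un_disjoint card_image inj_on_def)
  moreover have "card m = card A + card B"
    using m fin by (auto simp: card_Un_disjoint)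
  ultimately have "p = (card A + card S) mod 2" "q = (card B + card S) mod 2" "card m = card A + card B"
    by auto
  then show "card m mod 2 = (p + q) mod 2"
    by (auto simp: mod_add_eq) presburger
qed

section \<open>The first-order term and the Poisson bracket\<close>

text \<open>Half of the bracket, namely the terms that contract a \<open>y\<close> on the left with
  an \<open>x\<close> on the right, truncated as the star product is.\<close>

definition B1 :: "'k::comm_ring_1 fsum \<Rightarrow> 'k fsum \<Rightarrow> 'k fsum" where
  "B1 f g = (\<lambda>m. \<Sum>i<bnd m. gmult (RD (Y i) f) (LD (X i) g) m)"

lemma gmult_add_left: "gmult (\<lambda>m. f m + f' m) g m = gmult f g m + gmult f' g m"
  by (simp add: gmult_eq_mu distrib_right mu_add)

lemma gmult_add_right: "gmult f (\<lambda>m. g m + g' m) m = gmult f g m + gmult f g' m"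
  by (simp add: gmult_eq_mu distrib_left mu_add)

lemma gmult_cmult_left: "gmult (\<lambda>m. c * f m) g m = c * gmult f g m"
  by (simp add: gmult_eq_mu mult.assoc mu_cmult)

lemma gmult_cmult_right: "gmult f (\<lambda>m. c * g m) m = c * gmult f g m"
  by (simp add: gmult_eq_mu mult.left_commute[of _ c] mu_cmult)

lemma gmult_zero [simp]: "gmult (\<lambda>m. 0) g m = 0" "gmult f (\<lambda>m. 0) m = 0"
  by (simp_all add: gmult_eq_mu)

lemma gmult_sum_left: "gmult (\<lambda>m. \<Sum>i<n. u i m) g m = (\<Sum>i<(n::nat). gmult (u i) g m)"
  by (induction n) (simp_all add: gmult_add_left)

lemma gmult_sum_right: "gmult f (\<lambda>m. \<Sum>i<n. u i m) m = (\<Sum>i<(n::nat). gmult f (u i) m)"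
  by (induction n) (simp_all add: gmult_add_right)

lemma gmult_infinite: "infinite m \<Longrightarrow> gmult f g m = 0"
  by (simp add: gmult_eq_mu mu_infinite)

lemma gmult_cong:
  assumes "\<And>A B. finite m \<Longrightarrow> A \<inter> B = {} \<Longrightarrow> A \<union> B = m \<Longrightarrow> f A * g B = f' A * g' B"
  shows "gmult f g m = gmult f' g' m"
  unfolding gmult_eq_mu by (rule mu_cong) (use assms in auto)

lemma gmult_eq_star: "gmult f g = star 0 f g"
proof -
  have "PP 0 n F = F" for n and F :: "gen set \<Rightarrow> gen set \<Rightarrow> 'a"
    by (induction n) simp_all
  then show ?thesis
    by (simp add: star_def starN_def gmult_eq_mu)
qed

lemma gmult_Htilde: "f \<in> Htilde \<Longrightarrow> g \<in> Htilde \<Longrightarrow> gmult f g \<in> Htilde"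
  by (simp add: gmult_eq_star star_Htilde)

lemma bterm_eq_gmult: "bterm f g c d m = gmult (RD c f) (LD d g) m"
proof (cases "finite m")
  case True
  then show ?thesis
    unfolding bterm_def gmult_def RD_def LD_def
    by (intro sum.cong refl) (auto simp: rsign_insert lsign_insert finite_subset mult_ac)
qed (simp add: bterm_def gmult_infinite)

lemma adm_insert_X: "finite m \<Longrightarrow> B \<subseteq> m \<Longrightarrow> bnd m \<le> i \<Longrightarrow> \<not> adm (insert (X i) B)"
proof
  assume m: "finite m" "B \<subseteq> m" "bnd m \<le> i" and "adm (insert (X i) B)"
  then obtain j where "j > i" "Y j \<in> B" by (auto simp: adm_iff)
  with m show False using bnd_le_iff[of m i] by auto
qed

lemma gmult_LD_X_eq_0:
  assumes "g \<in> Htilde" "finite m" "bnd m \<le> i"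
  shows "gmult f (LD (X i) g) m = 0"
proof -
  have "gmult f (LD (X i) g) m = gmult f (\<lambda>_. 0) m"
  proof (rule gmult_cong)
    fix A B assume "A \<union> B = m"
    then have "g (insert (X i) B) = 0"
      using adm_insert_X[of m B i] assms Htilde_adm by blast
    then show "f A * LD (X i) g B = f A * 0" by (simp add: LD_def)
  qed
  then show ?thesis by simp
qed

lemma gmult_RD_X_eq_0:
  assumes "f \<in> Htilde" "finite m" "bnd m \<le> i"
  shows "gmult (RD (X i) f) g m = 0"
proof -
  have "gmult (RD (X i) f) g m = gmult (\<lambda>_. 0) g m"
  proof (rule gmult_cong)
    fix A B assume "A \<union> B = m"
    then have "f (insert (X i) A) = 0"
      using adm_insert_X[of m A i] assms Htilde_adm by blast
    then show "RD (X i) f A * g B = 0 * g B" by (simp add: RD_def)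
  qed
  then show ?thesis by simp
qed

lemma B1_eq_sum:
  assumes "g \<in> Htilde" "finite m" "bnd m \<le> n"
  shows "B1 f g m = (\<Sum>i<n. gmult (RD (Y i) f) (LD (X i) g) m)"
  unfolding B1_def using assms by (intro sum.mono_neutral_left) (auto simp: gmult_LD_X_eq_0)

lemma B1_infinite: "infinite m \<Longrightarrow> B1 f g m = 0"
  by (simp add: B1_def gmult_infinite)

text \<open>\<open>Sum_any\<close> defaults to 0 on infinite supports. Here admissibility of both
  arguments kills all contractions of index at least \<open>bnd m\<close>, so the sum is a genuine
  finite one.\<close>

lemma pbracket_eq_sum:
  assumes "f \<in> Htilde" "g \<in> Htilde" "finite m"
  shows "pbracket f g m = (\<Sum>i<bnd m. gmult (RD (Y i) f) (LD (X i) g) m + gmult (RD (X i) f) (LD (Y i) g) m)"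
  unfolding pbracket_def bterm_eq_gmult
proof (rule Sum_any.expand_superset)
  show "{i. gmult (RD (Y i) f) (LD (X i) g) m + gmult (RD (X i) f) (LD (Y i) g) m \<noteq> 0} \<subseteq> {..<bnd m}"
    using gmult_LD_X_eq_0[OF assms(2,3)] gmult_RD_X_eq_0[OF assms(1,3)]
    by (intro subsetI, simp only: mem_Collect_eq lessThan_iff) (rule ccontr, simp)
qed simp

lemma pbracket_infinite: "infinite m \<Longrightarrow> pbracket f g m = 0"
  by (simp add: pbracket_def bterm_eq_gmult gmult_infinite)

lemma hom_even: "hom p f \<Longrightarrow> f m \<noteq> 0 \<Longrightarrow> even (card m) \<longleftrightarrow> even p"
  by (auto simp: hom_def even_iff_mod_2_eq_zero)

lemma minus_one_power_cong: "(even a \<longleftrightarrow> even b) \<Longrightarrow> (-1::'k::comm_ring_1) ^ a = (-1) ^ b"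
  by (simp add: minus_one_power_iff)

text \<open>The parity condition is put on pairs of supporting monomials with a free exponent
  \<open>e\<close>, so that it applies equally to derivatives, whose parity is shifted by
  one.\<close>

lemma gmult_commute_sign:
  assumes "\<And>A B. f A \<noteq> 0 \<Longrightarrow> g B \<noteq> 0 \<Longrightarrow> even (card A * card B) \<longleftrightarrow> even e"
  shows "gmult f g m = (-1) ^ e * gmult g f m"
proof (cases "finite m")
  case fin: True
  have "gmult f g m = (\<Sum>A\<in>Pow m. msign (m - A) A * f (m - A) * g A)"
    unfolding gmult_def
    by (rule sum.reindex_bij_witness[where i="\<lambda>A. m - A" and j="\<lambda>A. m - A"]) (auto simp: double_diff)
  also have "\<dots> = (\<Sum>A\<in>Pow m. (-1) ^ e * (msign A (m - A) * g A * f (m - A)))"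
  proof (rule sum.cong)
    fix A assume A: "A \<in> Pow m"
    show "msign (m - A) A * f (m - A) * g A = (-1) ^ e * (msign A (m - A) * g A * f (m - A))"
    proof (cases "f (m - A) = 0 \<or> g A = 0")
      case False
      then have "(-1::'a) ^ (card (m - A) * card A) = (-1) ^ e"
        using assms by (intro minus_one_power_cong) auto
      moreover have "msign (m - A) A * msign A (m - A) = ((-1::'a) ^ (card (m - A) * card A))"
        using A fin by (intro msign_swap) (auto simp: finite_subset)
      ultimately have "msign (m - A) A * msign A (m - A) * msign A (m - A) = (-1) ^ e * (msign A (m - A) :: 'a)"
        by simp
      then have "msign (m - A) A = (-1) ^ e * (msign A (m - A) :: 'a)"
        by (simp add: mult.assoc)
      then show ?thesis by (simp add: mult_ac)
    qed auto
  qed simp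
  also have "\<dots> = (-1) ^ e * gmult g f m"
    by (simp add: gmult_def sum_distrib_left)
  finally show ?thesis .
qed (simp add: gmult_infinite)

lemma RD_parity: "hom p f \<Longrightarrow> RD c f A \<noteq> 0 \<Longrightarrow> even (card A) \<longleftrightarrow> odd p"
  by (auto simp: RD_def split: if_splits dest: hom_even[of p f "insert c A"])

lemma LD_parity: "hom p f \<Longrightarrow> LD c f A \<noteq> 0 \<Longrightarrow> even (card A) \<longleftrightarrow> odd p"
  by (auto simp: LD_def split: if_splits dest: hom_even[of p f "insert c A"])

lemma RD_eq_LD:
  assumes "hom p f"
  shows "RD c f = (\<lambda>A. (-1) ^ Suc p * LD c f A)"
proof
  fix A
  show "RD c f A = (-1) ^ Suc p * LD c f A"
  proof (cases "finite A \<and> c \<notin> A \<and> f (insert c A) \<noteq> 0")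
    case True
    then have "even (card (insert c A)) \<longleftrightarrow> even p" by (intro hom_even[OF assms]) auto
    with True have "(-1::'a) ^ card A = (-1) ^ Suc p" by (intro minus_one_power_cong) auto
    with True show ?thesis
      by (simp add: RD_def LD_def msign_swap_single[of A c] mult.assoc del: power_Suc)
  qed (auto simp: RD_def LD_def)
qed

text \<open>The remaining half of the bracket is \<open>B1 g f\<close> in disguise: exchanging left
  and right derivatives and then commuting the factors gives the total sign
  \<open>- (-1) ^ (p * q)\<close>.\<close>

lemma pbracket_hom:
  fixes f g :: "'k::comm_ring_1 fsum"
  assumes "f \<in> Htilde" "g \<in> Htilde" "hom p f" "hom q g"
  shows "pbracket f g m = B1 f g m - (-1) ^ (p * q) * B1 g f m"
proof (cases "finite m")
  case True
  have "gmult (RD (X i) f) (LD (Y i) g) m = - ((-1) ^ (p * q) * gmult (RD (Y i) g) (LD (X i) f) m)" for i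
  proof -
    have g: "LD (Y i) g = (\<lambda>A. (-1) ^ Suc q * RD (Y i) g A)"
      unfolding RD_eq_LD[OF assms(4)] by (simp add: fun_eq_iff)
    have "gmult (RD (X i) f) (LD (Y i) g) m
        = (-1) ^ Suc p * ((-1) ^ Suc q * gmult (LD (X i) f) (RD (Y i) g) m)"
      unfolding g RD_eq_LD[OF assms(3)] gmult_cmult_left gmult_cmult_right by simp
    also have "gmult (LD (X i) f) (RD (Y i) g) m = (-1) ^ (Suc p * Suc q) * gmult (RD (Y i) g) (LD (X i) f) m"
      by (rule gmult_commute_sign) (use LD_parity[OF assms(3)] RD_parity[OF assms(4)] in auto)
    also have "(-1) ^ Suc p * ((-1) ^ Suc q * ((-1) ^ (Suc p * Suc q) * gmult (RD (Y i) g) (LD (X i) f) m))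
       = (-1) ^ (Suc p + Suc q + Suc p * Suc q) * gmult (RD (Y i) g) (LD (X i) f) m"
      by (simp only: power_add mult.assoc)
    also have "(-1::'k) ^ (Suc p + Suc q + Suc p * Suc q) = (-1) ^ Suc (p * q)"
      by (rule minus_one_power_cong) auto
    finally show ?thesis by simp
  qed
  then show ?thesis
    using True assms by (simp add: pbracket_eq_sum B1_def sum_subtractf sum_distrib_left)
qed (simp add: pbracket_infinite B1_infinite)

lemma RD_add: "RD c (\<lambda>m. f m + g m) = (\<lambda>m. RD c f m + RD c g m)"
  and LD_add: "LD c (\<lambda>m. f m + g m) = (\<lambda>m. LD c f m + LD c g m)"
  and LD_cmult: "LD c (\<lambda>m. a * f m) = (\<lambda>m. a * LD c f m)"
  by (auto simp: RD_def LD_def algebra_simps)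

lemma B1_add_right: "B1 f (\<lambda>m. g m + g' m) = (\<lambda>m. B1 f g m + B1 f g' m)"
  and B1_cmult_right: "B1 f (\<lambda>m. c * g m) = (\<lambda>m. c * B1 f g m)"
  by (simp_all add: B1_def LD_add LD_cmult gmult_add_right gmult_cmult_right sum.distrib sum_distrib_left)

lemma pbracket_add_left:
  assumes "f \<in> Htilde" "f' \<in> Htilde" "g \<in> Htilde" "(\<lambda>m. f m + f' m) \<in> Htilde"
  shows "pbracket (\<lambda>m. f m + f' m) g = (\<lambda>m. pbracket f g m + pbracket f' g m)"
proof
  fix m show "pbracket (\<lambda>m. f m + f' m) g m = pbracket f g m + pbracket f' g m"
    using assms by (cases "finite m")
      (simp_all add: pbracket_eq_sum pbracket_infinite RD_add gmult_add_left algebra_simps flip: sum.distrib)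
qed

lemma pbracket_add_right:
  assumes "f \<in> Htilde" "g \<in> Htilde" "g' \<in> Htilde" "(\<lambda>m. g m + g' m) \<in> Htilde"
  shows "pbracket f (\<lambda>m. g m + g' m) = (\<lambda>m. pbracket f g m + pbracket f g' m)"
proof
  fix m show "pbracket f (\<lambda>m. g m + g' m) m = pbracket f g m + pbracket f g' m"
    using assms by (cases "finite m")
      (simp_all add: pbracket_eq_sum pbracket_infinite LD_add gmult_add_right algebra_simps flip: sum.distrib)
qed

section \<open>The Leibniz rule for the first-order term, and left factors linear in the
  \<open>y_i\<close>\<close>

lemma LD_gmult:
  assumes "hom q b"
  shows "LD d (gmult b c) m = gmult (LD d b) c m + (-1) ^ q * gmult b (LD d c) m"
proof -
  have "LD d (\<lambda>a. b a * c B) A = LD d b A * c B" "LD d (\<lambda>B. b A * c B) B = b A * LD d c B" for A B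
    by (simp_all add: LD_def mult_ac)
  then have "LD d (gmult b c) m = mu (\<lambda>A B. LD d b A * c B + (-1) ^ card A * (b A * LD d c B)) m"
    by (simp add: gmult_eq_mu LD_mu)
  also have "\<dots> = mu (\<lambda>A B. LD d b A * c B + (-1) ^ q * (b A * LD d c B)) m"
  proof (rule mu_cong)
    fix A B
    have "b A = 0 \<or> (-1::'a) ^ card A = (-1) ^ q"
      using hom_even[OF assms] minus_one_power_cong by metis
    then show "LD d b A * c B + (-1) ^ card A * (b A * LD d c B)
             = LD d b A * c B + (-1) ^ q * (b A * LD d c B)" by auto
  qed
  finally show ?thesis by (simp add: mu_add mu_cmult gmult_eq_mu)
qed

text \<open>Moving \<open>b\<close> past the derivative of \<open>v\<close>, of parity
  \<open>p + 1\<close>, costs \<open>(-1) ^ (Suc p * q)\<close>; the derivative by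
  \<open>x_i\<close> crossing \<open>b\<close> costs \<open>(-1) ^ q\<close>. Together these give
  \<open>(-1) ^ (p * q)\<close>.\<close>

lemma B1_gmult:
  fixes v :: "'k::comm_ring_1 fsum"
  assumes "hom p v" "hom q b" "b \<in> Htilde" "c \<in> Htilde"
  shows "B1 v (gmult b c) = (\<lambda>m. gmult (B1 v b) c m + (-1) ^ (p * q) * gmult b (B1 v c) m)"
proof
  fix m
  show "B1 v (gmult b c) m = gmult (B1 v b) c m + (-1) ^ (p * q) * gmult b (B1 v c) m"
  proof (cases "finite m")
    case True
    define n where "n = bnd m"
    \<comment> \<open>The outer product evaluates \<open>B1\<close> at submonomials of
      \<open>m\<close>; all of them may use the truncation belonging to \<open>m\<close>.\<close>
    have sub: "bnd M \<le> n" "finite M" if "M \<subseteq> m" for M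
    proof -
      show "finite M" using that True by (rule finite_subset)
      then show "bnd M \<le> n"
        using that bnd_le_iff[of m n] True by (auto simp: bnd_le_iff n_def)
    qed
    have i: "gmult (RD (Y i) v) (LD (X i) (gmult b c)) m
        = gmult (gmult (RD (Y i) v) (LD (X i) b)) c m
         + (-1) ^ (p * q) * gmult b (gmult (RD (Y i) v) (LD (X i) c)) m" for i
    proof -
      have "gmult (RD (Y i) v) b = (\<lambda>m. (-1) ^ (Suc p * q) * gmult b (RD (Y i) v) m)"
        by (rule ext, rule gmult_commute_sign) (use RD_parity[OF assms(1)] hom_even[OF assms(2)] in auto)
      then have "gmult (RD (Y i) v) (gmult b (LD (X i) c)) m
          = (-1) ^ (Suc p * q) * gmult b (gmult (RD (Y i) v) (LD (X i) c)) m"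
        by (simp add: gmult_cmult_left flip: gmult_assoc)
      moreover have "(-1::'k) ^ q * (-1) ^ (Suc p * q) = (-1) ^ (p * q)"
        by (simp add: power_add)
      ultimately show ?thesis
        unfolding LD_gmult[OF assms(2)] gmult_add_right gmult_cmult_right gmult_assoc
        by (simp flip: mult.assoc)
    qed
    have "B1 v (gmult b c) m = (\<Sum>i<n. gmult (RD (Y i) v) (LD (X i) (gmult b c)) m)"
      by (simp add: B1_def n_def)
    also have "\<dots> = gmult (\<lambda>M. \<Sum>i<n. gmult (RD (Y i) v) (LD (X i) b) M) c m
       + (-1) ^ (p * q) * gmult b (\<lambda>M. \<Sum>i<n. gmult (RD (Y i) v) (LD (X i) c) M) m"
      unfolding i sum.distrib gmult_sum_left gmult_sum_right sum_distrib_left ..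
    also have "gmult (\<lambda>M. \<Sum>i<n. gmult (RD (Y i) v) (LD (X i) b) M) c m = gmult (B1 v b) c m"
      by (rule gmult_cong) (subst B1_eq_sum[OF assms(3), of _ n], use sub in auto)
    also have "gmult b (\<lambda>M. \<Sum>i<n. gmult (RD (Y i) v) (LD (X i) c) M) m = gmult b (B1 v c) m"
      by (rule gmult_cong) (subst B1_eq_sum[OF assms(4), of _ n], use sub in auto)
    finally show ?thesis .
  qed (simp add: B1_infinite gmult_infinite)
qed

text \<open>Two successive contractions would remove two \<open>y\<close> from a monomial of
  \<open>v\<close> that contains at most one, so only the first-order term remains.\<close>

lemma star_ylinear:
  assumes "\<And>m i j. v m \<noteq> 0 \<Longrightarrow> Y i \<in> m \<Longrightarrow> Y j \<in> m \<Longrightarrow> i = j"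
  shows "star t v g = (\<lambda>m. gmult v g m + t * B1 v g m)"
proof
  fix m
  let ?F = "\<lambda>A B. v A * g B"
  have E: "E i ?F = (\<lambda>A B. RD (Y i) v A * LD (X i) g B)" for i
    by (simp add: E_tensor fun_eq_iff)
  have "RD (Y j) (RD (Y i) v) A = 0" for i j A
    using assms[of "insert (Y i) (insert (Y j) A)" i j]
    by (cases "v (insert (Y i) (insert (Y j) A)) = 0") (auto simp: RD_def)
  then have "E j (E i ?F) = (\<lambda>A B. 0)" for i j
    by (simp add: E E_tensor fun_eq_iff)
  then have PP: "PP t n ?F = (\<lambda>A B. ?F A B + t * (\<Sum>i<n. E i ?F A B))" for n
    by (rule PP_linear)
  show "star t v g m = gmult v g m + t * B1 v g m"
    unfolding star_def starN_def PP
    by (simp add: mu_add mu_cmult mu_sum E gmult_eq_mu B1_def)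
qed

section \<open>Coefficients of the star product over power series\<close>

lemma msign_fps: "(msign A B :: 'k::comm_ring_1 fps) = fps_const (msign A B)"
  by (simp add: msign_def minus_one_power_iff flip: fps_const_neg)

lemma E_nth: "fps_nth (E i F A B) k = E i (\<lambda>A B. fps_nth (F A B) k) A B"
  by (simp add: E_apply msign_fps)

lemma mu_nth: "fps_nth (mu F m) k = mu (\<lambda>A B. fps_nth (F A B) k) m"
  by (simp add: mu_def msign_fps fps_sum_nth)

text \<open>\<open>star\<close> takes \<open>t\<close> from the coefficient ring. Over power series
  with \<open>t = fps_X\<close> the parameter becomes formal, and this embedding supplies the
  elements constant in \<open>t\<close>.\<close>

definition cst :: "'k::comm_ring_1 fsum \<Rightarrow> 'k fps fsum" where
  "cst f = (\<lambda>m. fps_const (f m))"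

lemma cst_add: "cst (\<lambda>m. f m + g m) = (\<lambda>m. cst f m + cst g m)"
  and cst_cmult: "cst (\<lambda>m. c * f m) = (\<lambda>m. fps_const c * cst f m)"
  by (simp_all add: cst_def)

lemma cst_gmult: "gmult (cst f) (cst g) = cst (gmult f g)"
  by (auto simp: gmult_eq_mu fun_eq_iff fps_eq_iff mu_nth) (simp add: cst_def)

lemma cst_B1: "B1 (cst f) (cst g) = cst (B1 f g)"
proof -
  have "RD c (cst f) = cst (RD c f)" "LD c (cst f) = cst (LD c f)" for c and f :: "'a fsum"
    by (auto simp: RD_def LD_def cst_def msign_fps)
  then have "B1 (cst f) (cst g) = (\<lambda>m. \<Sum>i<bnd m. cst (gmult (RD (Y i) f) (LD (X i) g)) m)"
    by (simp add: B1_def cst_gmult)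
  then show ?thesis
    by (simp add: B1_def cst_def fps_eq_iff fun_eq_iff fps_sum_nth)
qed

lemma PP_nth_0: "fps_nth (PP fps_X n F A B) 0 = fps_nth (F A B) 0"
  by (induction n arbitrary: A B) simp_all

lemma PP_nth_1: "fps_nth (PP fps_X n F A B) 1 = fps_nth (F A B) 1 + (\<Sum>i<n. E i (\<lambda>A B. fps_nth (F A B) 0) A B)"
  by (induction n arbitrary: A B) (simp_all add: E_nth PP_nth_0)

lemma star_nth_0: "fps_nth (star fps_X (cst a) (cst b) m) 0 = gmult a b m"
  by (simp add: star_def starN_def mu_nth PP_nth_0 gmult_eq_mu) (simp add: cst_def)

lemma star_nth_1: "fps_nth (star fps_X (cst a) (cst b) m) 1 = B1 a b m"
  unfolding star_def starN_def mu_nth PP_nth_1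
  by (simp add: cst_def E_tensor mu_sum B1_def gmult_eq_mu)

section \<open>Monomial multiples of the pivot elements\<close>

text \<open>These are the indices of the \<open>x\<close> factors in the \<open>k\<close>-th summand
  of \<open>V n\<close>.\<close>

definition C :: "nat \<Rightarrow> nat \<Rightarrow> nat set" where
  "C n k = {x. \<exists>r<k. x = n + 3 * r \<or> x = n + 3 * r + 1}"

definition wm :: "nat set \<Rightarrow> nat \<Rightarrow> nat \<Rightarrow> gen set" where
  "wm A n k = insert (Y (n + 3 * k)) (X ` (A \<union> C n k))"

text \<open>The element \<open>x\<^sup>A V\<^sub>n\<close>; there are no signs, since the indices in \<open>A\<close> will be smaller than \<open>n\<close>.\<close>

definition W :: "nat set \<Rightarrow> nat \<Rightarrow> 'k::comm_ring_1 fsum" where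
  "W A n = (\<lambda>m. if \<exists>k. m = wm A n k then 1 else 0)"

text \<open>The gap 2 is the one that \<open>C_bounds\<close> gives between the \<open>x\<close> and
  the \<open>y\<close> indices within a summand, so absorbing such a piece into \<open>A\<close>
  preserves goodness, see \<open>B1_W\<close>.\<close>

definition good :: "nat set \<Rightarrow> nat \<Rightarrow> bool" where
  "good A n \<longleftrightarrow> (\<forall>a\<in>A. a + 2 \<le> n)"

lemma good_finite: "good A n \<Longrightarrow> finite A"
  by (rule finite_subset[of _ "{..n}"]) (auto simp: good_def)

lemma finite_C [simp]: "finite (C n k)"
  by (rule finite_subset[of _ "{..n + 3 * k}"]) (auto simp: C_def)

lemma C_bounds: "x \<in> C n k \<Longrightarrow> n \<le> x \<and> x + 2 \<le> n + 3 * k"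
  by (auto simp: C_def)

lemma good_C_disjoint: "good A n \<Longrightarrow> A \<inter> C n k = {}"
  using C_bounds[of _ n k] by (fastforce simp: good_def)

lemma C_0 [simp]: "C n 0 = {}"
  by (simp add: C_def)

lemma C_Suc: "C n (Suc k) = insert (n + 3 * k) (insert (n + 3 * k + 1) (C n k))"
  by (auto simp: C_def less_Suc_eq)

lemma C_add: "C n (k + l) = C n k \<union> C (n + 3 * k) l"
  by (induction l) (auto simp: C_Suc algebra_simps)

text \<open>The sets \<open>C m l\<close> are initial segments of one increasing sequence of
  indices.\<close>

lemma C_less:
  assumes "x \<in> C m l" "x' \<in> C m l'" "x < x'"
  shows "x \<in> C m l'"
proof -
  obtain r r' where "x = m + 3 * r \<or> x = m + 3 * r + 1" "r' < l'" "x' = m + 3 * r' \<or> x' = m + 3 * r' + 1"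
    using assms by (auto simp: C_def)
  moreover from this assms(3) have "r < l'" by auto
  ultimately show ?thesis by (auto simp: C_def)
qed

lemma even_card_C: "even (card (C n k))"
  by (induction k) (auto simp: C_Suc card_insert_if dest: C_bounds)

lemma finite_wm [simp]: "good A n \<Longrightarrow> finite (wm A n k)"
  by (simp add: wm_def good_finite)

lemma V_eq_W: "V n = W {} n"
proof -
  have "Vmono n k = wm {} n k" for k
    by (auto simp: Vmono_def wm_def C_def)
  then show ?thesis by (simp add: V_def W_def)
qed

lemma W_Htilde:
  assumes "good A n"
  shows "W A n \<in> Htilde"
proof -
  have "\<exists>j>i. Y j \<in> wm A n k" if "X i \<in> wm A n k" for i k
  proof (intro exI conjI)
    have "i \<in> A \<or> i \<in> C n k" using that by (auto simp: wm_def)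
    then show "i < n + 3 * k" using assms C_bounds[of i n k] by (auto simp: good_def)
  qed (simp add: wm_def)
  then show ?thesis
    using assms by (auto simp: Htilde_def W_def adm_iff)
qed

lemma W_ylinear: "W A n m \<noteq> 0 \<Longrightarrow> Y i \<in> m \<Longrightarrow> Y j \<in> m \<Longrightarrow> i = j"
  by (auto simp: W_def wm_def split: if_splits)

lemma card_X_image: "card (X ` A) = card A"
  by (simp add: card_image inj_on_def)

lemma W_hom:
  assumes "good A n"
  shows "hom (Suc (card A) mod 2) (W A n)"
  unfolding hom_def
proof safe
  fix m :: "gen set" assume "W A n m \<noteq> (0::'a)"
  then obtain k where m: "m = wm A n k" by (auto simp: W_def split: if_splits)
  have "A \<inter> C n k = {}" using assms by (rule good_C_disjoint)
  moreover have "card m = Suc (card (A \<union> C n k))"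
    unfolding m wm_def using assms by (subst card_insert_disjoint) (auto simp: good_finite card_X_image)
  ultimately have "card m = Suc (card A + card (C n k))"
    using assms by (simp add: card_Un_disjoint good_finite)
  then show "card m mod 2 = Suc (card A) mod 2"
    using even_card_C[of n k] by presburger
qed

section \<open>Contractions between two monomial multiples\<close>

lemma msign_eq_1: "(\<And>a b. a \<in> A \<Longrightarrow> b \<in> B \<Longrightarrow> \<not> gless b a) \<Longrightarrow> msign A B = 1"
proof -
  assume "\<And>a b. a \<in> A \<Longrightarrow> b \<in> B \<Longrightarrow> \<not> gless b a"
  then have "{(a, b). a \<in> A \<and> b \<in> B \<and> gless b a} = {}" by auto
  then show ?thesis by (simp only: msign_def card.empty power_0)
qed

text \<open>Contraction of the \<open>k\<close>-th monomial of \<open>W A n\<close> with the \<open>l\<close>-th monomial of \<open>W B m\<close> is possible.\<close>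

definition contr :: "nat set \<Rightarrow> nat \<Rightarrow> nat set \<Rightarrow> nat \<Rightarrow> nat \<Rightarrow> nat \<Rightarrow> bool" where
  "contr A n B m k l \<longleftrightarrow> n + 3 * k \<in> B \<union> C m l \<and> (A \<union> C n k) \<inter> (B \<union> C m l - {n + 3 * k}) = {}"

text \<open>For \<open>k < k'\<close> the longer left monomial contains \<open>x\<close> of index
  \<open>n + 3 * k\<close>. So does the right monomial, either through \<open>B\<close> or because
  the tails are nested; the product in the second contraction would therefore repeat that
  \<open>x\<close>.\<close>

lemma contr_not_less:
  assumes "good B m" "contr A n B m k l" "contr A n B m k' l'"
  shows "\<not> k < k'"
proof
  assume k: "k < k'"
  have "n + 3 * k \<in> B \<union> C m l'"
  proof (cases "n + 3 * k \<in> B")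
    case False
    then have i: "n + 3 * k \<in> C m l" using assms(2) by (auto simp: contr_def)
    then have "m \<le> n + 3 * k" using C_bounds by blast
    then have "n + 3 * k' \<notin> B" using k assms(1) by (auto simp: good_def)
    then have "n + 3 * k' \<in> C m l'" using assms(3) by (auto simp: contr_def)
    with i have "n + 3 * k \<in> C m l'"
      by (rule C_less) (use k in simp)
    then show ?thesis by simp
  qed simp
  moreover have "n + 3 * k \<in> C n k'" using k by (auto simp: C_def)
  ultimately show False using assms(3) k by (auto simp: contr_def)
qed

lemma contr_unique:
  "good B m \<Longrightarrow> contr A n B m k l \<Longrightarrow> contr A n B m k' l' \<Longrightarrow> k' = k"
  using contr_not_less by (meson linorder_neqE_nat)

lemma contraction_nonzero:
  assumes "RD (Y i) (W A n) Z * LD (X i) (W B m) Z' \<noteq> (0::'k::comm_ring_1)" and "Z \<inter> Z' = {}"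
  obtains k l where "i = n + 3 * k" "Z = X ` (A \<union> C n k)"
    "Z' = insert (Y (m + 3 * l)) (X ` (B \<union> C m l - {i}))" "contr A n B m k l"
proof -
  have "Y i \<notin> Z" "W A n (insert (Y i) Z) \<noteq> (0::'k)" "X i \<notin> Z'" "W B m (insert (X i) Z') \<noteq> (0::'k)"
    using assms(1) by (auto simp: RD_def LD_def split: if_splits)
  then obtain k l where Z: "Y i \<notin> Z" "insert (Y i) Z = wm A n k"
    and Z': "X i \<notin> Z'" "insert (X i) Z' = wm B m l"
    by (auto simp: W_def split: if_splits)
  have i: "i = n + 3 * k" using Z(2) by (auto simp: wm_def)
  have "Z = wm A n k - {Y i}" using Z by auto
  then have Zk: "Z = X ` (A \<union> C n k)" by (auto simp: wm_def i)
  have "Z' = wm B m l - {X i}" using Z' by auto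
  then have Zl: "Z' = insert (Y (m + 3 * l)) (X ` (B \<union> C m l - {i}))" by (auto simp: wm_def)
  have "X i \<in> wm B m l" using Z' by auto
  then have "i \<in> B \<union> C m l" by (auto simp: wm_def)
  then have "contr A n B m k l"
    using assms(2) unfolding Zk Zl i contr_def by auto
  with i Zk Zl show thesis by (rule that)
qed

lemma B1_W_eq_0:
  assumes "\<And>k l. \<not> contr A n B m k l"
  shows "B1 (W A n) (W B m) = (\<lambda>z. 0 :: 'k::comm_ring_1)"
proof -
  have "RD (Y i) (W A n) Z * LD (X i) (W B m) (z - Z) = (0::'k)" for i Z z
  proof (rule ccontr)
    assume h: "RD (Y i) (W A n) Z * LD (X i) (W B m) (z - Z) \<noteq> (0::'k)"
    show False by (rule contraction_nonzero[OF h Diff_disjoint]) (use assms in blast)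
  qed
  then show ?thesis
    by (simp add: B1_def gmult_def mult.assoc)
qed

text \<open>By \<open>contr_unique\<close> only one index \<open>i\<close> can be contracted, and
  the left monomial is fixed. Every right summand from the first one containing \<open>x_i\<close>
  onward extends it by a tail of \<open>V (m + 3 * l)\<close>, so the sum is again a monomial
  multiple of a \<open>V\<close>, with one common sign.\<close>

lemma B1_W:
  fixes A B n m k l
  defines "i \<equiv> n + 3 * k"
  defines "P \<equiv> A \<union> C n k"
  defines "Q \<equiv> B \<union> C m l - {i}"
  assumes A: "good A n" and B: "good B m" and contr: "contr A n B m k l"
    and least: "\<forall>l'<l. i \<notin> B \<union> C m l'"
  shows "good (P \<union> Q) (m + 3 * l)"
    and "B1 (W A n) (W B m) = (\<lambda>z. msign {X i} (X ` Q) * msign (X ` P) (X ` Q) * W (P \<union> Q) (m + 3 * l) z :: 'k::comm_ring_1)"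
proof -
  have iQ: "i \<in> B \<union> C m l" and PQ: "P \<inter> Q = {}"
    using contr by (auto simp: contr_def i_def P_def Q_def)
  have ibound: "i + 2 \<le> m + 3 * l"
    using iQ B C_bounds[of i m l] by (auto simp: good_def)
  have Pbound: "x + 2 \<le> i" if "x \<in> P" for x
    using that A C_bounds[of x n k] by (auto simp: P_def good_def i_def)
  have Qbound: "x + 2 \<le> m + 3 * l" if "x \<in> Q" for x
    using that B C_bounds[of x m l] by (auto simp: Q_def good_def)
  have fin: "finite P" "finite Q"
    using A B by (auto simp: P_def Q_def good_finite)
  show "good (P \<union> Q) (m + 3 * l)"
    unfolding good_def
  proof
    fix x assume "x \<in> P \<union> Q"
    then show "x + 2 \<le> m + 3 * l" using Pbound[of x] Qbound[of x] ibound by auto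
  qed
  show "B1 (W A n) (W B m) = (\<lambda>z. msign {X i} (X ` Q) * msign (X ` P) (X ` Q) * W (P \<union> Q) (m + 3 * l) z :: 'k)"
  proof
    fix z
    let ?Z = "X ` P"
    let ?h = "\<lambda>j Z. RD (Y j) (W A n) Z * LD (X j) (W B m) (z - Z) :: 'k"
    show "B1 (W A n) (W B m) z = msign {X i} (X ` Q) * msign (X ` P) (X ` Q) * (W (P \<union> Q) (m + 3 * l) z :: 'k)"
    proof (cases "finite z")
      case finz: True
      have nz: "j = i \<and> Z = ?Z" if h: "?h j Z \<noteq> 0" for j Z
      proof -
        obtain k' l' where "j = n + 3 * k'" "Z = X ` (A \<union> C n k')"
          "z - Z = insert (Y (m + 3 * l')) (X ` (B \<union> C m l' - {j}))" "contr A n B m k' l'"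
          by (rule contraction_nonzero[OF h Diff_disjoint])
        with contr_unique[OF B contr] show ?thesis by (auto simp: i_def P_def)
      qed
      \<comment> \<open>\<open>Suc i\<close> guarantees that the sum reaches the contracted index;
        \<open>B1_eq_sum\<close> allows any bound above \<open>bnd z\<close>.\<close>
      define N where "N = max (bnd z) (Suc i)"
      have "B1 (W A n) (W B m) z = (\<Sum>j<N. \<Sum>Z\<in>Pow z. msign Z (z - Z) * ?h j Z)"
        using finz by (subst B1_eq_sum[OF W_Htilde[OF B], of _ N]) (auto simp: N_def gmult_def mult.assoc)
      also have "\<dots> = (\<Sum>j\<in>{i}. \<Sum>Z\<in>Pow z. msign Z (z - Z) * ?h j Z)"
      proof (rule sum.mono_neutral_right)
        show "\<forall>j\<in>{..<N} - {i}. (\<Sum>Z\<in>Pow z. msign Z (z - Z) * ?h j Z) = 0"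
          using nz by (intro ballI sum.neutral) (metis DiffD2 mult_zero_right singletonI)
      qed (auto simp: N_def)
      also have "\<dots> = (\<Sum>Z\<in>Pow z. if Z = ?Z then msign ?Z (z - ?Z) * ?h i ?Z else 0)"
        using nz by (simp del: mult_eq_0_iff) (intro sum.cong refl, metis mult_zero_right)
      also have "\<dots> = (if ?Z \<subseteq> z then msign ?Z (z - ?Z) * ?h i ?Z else 0)"
        using finz by simp
      also have "\<dots> = msign {X i} (X ` Q) * msign (X ` P) (X ` Q) * (W (P \<union> Q) (m + 3 * l) z :: 'k)"
      proof (cases "\<exists>l'. z = wm (P \<union> Q) (m + 3 * l) l'")
        case True
        then obtain l' where z: "z = wm (P \<union> Q) (m + 3 * l) l'" by blast
        \<comment> \<open>The tail added after the \<open>l\<close>-th summand. All its indices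
          exceed \<open>i\<close> and those of \<open>P\<close> and \<open>Q\<close>, so it
          contributes no sign.\<close>
        define D where "D = C (m + 3 * l) l'"
        have Dbound: "m + 3 * l \<le> x" if "x \<in> D" for x
          using that C_bounds by (auto simp: D_def)
        have PD: "P \<inter> D = {}" and QD: "Q \<inter> D = {}" and iD: "i \<notin> D"
          using Pbound Qbound Dbound ibound by fastforce+
        let ?T = "insert (Y (m + 3 * l + 3 * l')) (X ` D)"
        have zZ: "z - ?Z = X ` Q \<union> ?T"
          using PQ PD by (auto simp: z wm_def D_def)
        have iT: "X i \<notin> X ` Q \<union> ?T" using iD by (auto simp: Q_def)
        have fT: "finite ?T" "X ` Q \<inter> ?T = {}" using QD by (auto simp: D_def)
        have "insert (X i) (X ` Q \<union> ?T) = wm B m (l + l')"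
          using iQ by (auto simp: wm_def C_add D_def Q_def algebra_simps)
        then have WB: "W B m (insert (X i) (X ` Q \<union> ?T)) = (1::'k)" by (auto simp: W_def)
        have "insert (Y i) ?Z = wm A n k"
          by (simp add: wm_def P_def i_def)
        then have WA: "W A n (insert (Y i) ?Z) = (1::'k)" by (auto simp: W_def)
        have 1: "msign ?Z {Y i} = (1::'k)" by (rule msign_eq_1) auto
        have "msign {X i} ?T = (1::'k)"
          using Dbound ibound by (intro msign_eq_1) fastforce
        then have 2: "msign {X i} (X ` Q \<union> ?T) = (msign {X i} (X ` Q) :: 'k)"
          using fT fin by (simp only: msign_Un_right finite.intros finite_imageI mult_1_right)
        have "msign ?Z ?T = (1::'k)"
          using Dbound ibound Pbound by (intro msign_eq_1) fastforce
        then have 3: "msign ?Z (z - ?Z) = (msign ?Z (X ` Q) :: 'k)"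
          using fT fin by (simp only: zZ msign_Un_right finite_imageI mult_1_right)
        have "RD (Y i) (W A n) ?Z = (1::'k)"
          using fin by (auto simp: RD_def 1 WA)
        moreover have "LD (X i) (W B m) (z - ?Z) = (msign {X i} (X ` Q) :: 'k)"
          using fT(1) fin iT by (simp only: LD_def zZ 2 WB finite_Un finite_imageI) simp
        moreover have "?Z \<subseteq> z" by (auto simp: z wm_def)
        moreover have "W (P \<union> Q) (m + 3 * l) z = (1::'k)" using True by (simp add: W_def)
        ultimately show ?thesis by (simp add: 3 mult_ac)
      next
        case False
        then have W0: "W (P \<union> Q) (m + 3 * l) z = (0::'k)" by (simp add: W_def)
        have "?h i ?Z = 0" if Zz: "?Z \<subseteq> z"
        proof (rule ccontr)
          assume h: "?h i ?Z \<noteq> 0"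
          obtain k' l' where k': "i = n + 3 * k'" "?Z = X ` (A \<union> C n k')"
            "z - ?Z = insert (Y (m + 3 * l')) (X ` (B \<union> C m l' - {i}))" "contr A n B m k' l'"
            by (rule contraction_nonzero[OF h Diff_disjoint])
          then have "i \<in> B \<union> C m l'" by (auto simp: contr_def)
          with least have "l \<le> l'" by (meson not_le)
          \<comment> \<open>Minimality of \<open>l\<close> makes any other right summand a
            continuation by \<open>d\<close> blocks; then \<open>z\<close> would be a monomial of
            the claimed result.\<close>
          then obtain d where d: "l' = l + d" using le_Suc_ex by blast
          have "i \<notin> C (m + 3 * l) d" using ibound C_bounds[of i "m + 3 * l" d] by auto
          then have "B \<union> C m l' - {i} = Q \<union> C (m + 3 * l) d"
            by (auto simp: d C_add Q_def)
          moreover have "z = ?Z \<union> (z - ?Z)" using Zz by auto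
          ultimately have "z = wm (P \<union> Q) (m + 3 * l) d"
            unfolding k'(3) by (auto simp: wm_def d algebra_simps)
          with False show False by blast
        qed
        then show ?thesis by (simp add: W0)
      qed
      finally show ?thesis .
    next
      case False
      have "good (P \<union> Q) (m + 3 * l)" by fact
      then have "W (P \<union> Q) (m + 3 * l) z = (0::'k)"
        using False W_Htilde Htilde_infinite by blast
      then show ?thesis using False by (simp add: B1_infinite)
    qed
  qed
qed

text \<open>Shrinking \<open>l\<close> to the first summand that contains the contracted
  \<open>x\<close> only removes indices, so disjointness persists.\<close>

lemma contr_least:
  assumes "contr A n B m k l"
  obtains l0 where "contr A n B m k l0" "\<forall>l'<l0. n + 3 * k \<notin> B \<union> C m l'"
proof -
  define l0 where "l0 = (LEAST l. n + 3 * k \<in> B \<union> C m l)"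
  have l: "n + 3 * k \<in> B \<union> C m l" using assms by (simp add: contr_def)
  have 1: "n + 3 * k \<in> B \<union> C m l0" unfolding l0_def using l by (rule LeastI)
  have "l0 \<le> l" unfolding l0_def using l by (rule Least_le)
  then have "C m l0 \<subseteq> C m l" by (auto simp: C_def) (use order.strict_trans2 in blast)+
  then have "contr A n B m k l0" using assms 1 by (auto simp: contr_def)
  moreover have "\<forall>l'<l0. n + 3 * k \<notin> B \<union> C m l'"
    using not_less_Least unfolding l0_def by blast
  ultimately show thesis by (rule that)
qed

lemma B1_W_cases:
  assumes "good A n" "good B m"
  obtains "B1 (W A n) (W B m) = (\<lambda>z. 0)"
  | e D p where "good D p" "e * e = (1::'k::comm_ring_1)" "B1 (W A n) (W B m) = (\<lambda>z. e * W D p z)"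
proof (cases "\<exists>k l. contr A n B m k l")
  case True
  then obtain k l where "contr A n B m k l" by blast
  then obtain l0 where "contr A n B m k l0" "\<forall>l'<l0. n + 3 * k \<notin> B \<union> C m l'"
    by (rule contr_least)
  note l0 = this
  show thesis
    by (rule that(2)[OF B1_W(1)[OF assms l0] _ B1_W(2)[OF assms l0]]) (simp add: mult_ac)
qed (use that(1) B1_W_eq_0 in blast)

text \<open>Contractions in both orders force \<open>m\<close> onto the progression
  \<open>n, n + 3, ...\<close>. Both then remove the same pair \<open>y_m\<close>,
  \<open>x_m\<close>: \<open>y_m\<close> ends the \<open>k\<close>-th summand of one element and is
  the leading pivot of the other.\<close>

lemma contr_both:
  assumes A: "good A n" and B: "good B m" and "n \<le> m"
    and c: "contr A n B m k l" and least: "\<forall>j<l. n + 3 * k \<notin> B \<union> C m j"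
    and c': "contr B m A n k' l'" and least': "\<forall>j<l'. m + 3 * k' \<notin> A \<union> C n j"
  shows "m = n + 3 * k" "l = 1" "k' = 0" "l' = Suc k"
proof -
  let ?i = "n + 3 * k" and ?i' = "m + 3 * k'"
  have i: "?i \<in> B \<union> C m l" and d: "(A \<union> C n k) \<inter> (B \<union> C m l - {?i}) = {}"
    and i': "?i' \<in> A \<union> C n l'" and d': "(B \<union> C m k') \<inter> (A \<union> C n l' - {?i'}) = {}"
    using c c' by (auto simp: contr_def)
  have "?i' \<notin> A" using A \<open>n \<le> m\<close> by (auto simp: good_def)
  with i' obtain r where r: "r < l'" "?i' = n + 3 * r \<or> ?i' = n + 3 * r + 1" by (auto simp: C_def)
  \<comment> \<open>Otherwise \<open>?i\<close> would lie both in \<open>B\<close> and in the tail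
    \<open>C n l'\<close>, which the reverse contraction forbids.\<close>
  have iB: "?i \<notin> B"
  proof
    assume iB: "?i \<in> B"
    then have less: "?i + 2 \<le> m" using B by (auto simp: good_def)
    have "k < l'" using less r by auto
    then have "?i \<in> C n l'" by (auto simp: C_def)
    with iB d' less show False by auto
  qed
  with i obtain s where s: "s < l" "?i = m + 3 * s \<or> ?i = m + 3 * s + 1" by (auto simp: C_def)
  \<comment> \<open>Modulo 3 the two alternatives put both \<open>n - m\<close> and
    \<open>m - n\<close> into {0, 1}; hence both are 0, and the offsets by one are excluded.\<close>
  have s1: "?i = m + 3 * s" and r1: "?i' = n + 3 * r"
    using r(2) s(2) \<open>n \<le> m\<close> by presburger+
  \<comment> \<open>For \<open>s > 0\<close> the generator \<open>x_m\<close> would occur in both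
    tails \<open>C n k\<close> and \<open>C m l\<close> without being the contracted one.\<close>
  have s0: "s = 0"
  proof (rule ccontr)
    assume "s \<noteq> 0"
    have "m = n + 3 * (k - s)" "k - s < k" using s1 \<open>n \<le> m\<close> \<open>s \<noteq> 0\<close> by auto
    then have "m \<in> C n k" unfolding C_def by blast
    moreover have "m \<in> C m l" using s by (auto simp: C_def)
    ultimately show False using d s1 \<open>s \<noteq> 0\<close> by auto
  qed
  then show mk: "m = n + 3 * k" using s1 by simp
  show k0: "k' = 0"
  proof (rule ccontr)
    assume "k' \<noteq> 0"
    then have "m \<in> C m k'" by (auto simp: C_def)
    moreover have "k < l'" using mk r r1 by auto
    then have "m \<in> C n l'" unfolding C_def mk by auto
    ultimately show False using d' \<open>k' \<noteq> 0\<close> by auto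
  qed
  have "\<not> 1 < l" using least mk by (auto simp: C_def)
  then show "l = 1" using s by simp
  have "\<not> Suc k < l'" using least' mk k0 by (auto simp: C_def)
  moreover have "k < l'" using r r1 mk k0 by simp
  ultimately show "l' = Suc k" by simp
qed

text \<open>If both orders contract, \<open>contr_both\<close> makes both results multiples of the
  same element with pivot \<open>m + 3\<close>, and only the signs are left to compare. The last
  alternative says that the two halves of the bracket coincide.\<close>

lemma B1_W_swap_le:
  assumes A: "good A n" and B: "good B m" and "n \<le> m"
  shows "B1 (W A n) (W B m) = (\<lambda>z. 0 :: 'k::comm_ring_1) \<or> B1 (W B m) (W A n) = (\<lambda>z. 0 :: 'k) \<or>
    B1 (W A n) (W B m) = (\<lambda>z. - ((-1) ^ (Suc (card A) * Suc (card B)) * B1 (W B m) (W A n) z :: 'k))"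
proof (cases "(\<exists>k l. contr A n B m k l) \<and> (\<exists>k l. contr B m A n k l)")
  case True
  then obtain k l k' l' where
    c: "contr A n B m k l" "\<forall>j<l. n + 3 * k \<notin> B \<union> C m j" and
    c': "contr B m A n k' l'" "\<forall>j<l'. m + 3 * k' \<notin> A \<union> C n j"
    by (metis contr_least)
  note both = contr_both[OF A B \<open>n \<le> m\<close> c c']
  let ?P = "A \<union> C n k"
  have Pm: "x + 2 \<le> m" if "x \<in> ?P" for x
    using that A C_bounds[of x n k] by (auto simp: both(1) good_def)
  have Bm: "x + 2 \<le> m" if "x \<in> B" for x using that B by (auto simp: good_def)
  have fin: "finite A" "finite B" "finite ?P" using A B by (auto simp: good_finite)
  have Q: "B \<union> C m l - {n + 3 * k} = insert (m + 1) B"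
    unfolding both(2) both(1)[symmetric] by (auto simp: C_def dest: Bm)
  have Q': "A \<union> C n l' - {m + 3 * k'} = insert (m + 1) ?P"
    using Pm[of m] unfolding both(4,3) C_Suc both(1)[symmetric] by auto
  have PB: "?P \<inter> B = {}"
    using c(1) Bm both(1) by (force simp: contr_def)
  \<comment> \<open>Removing \<open>x_m\<close> crosses exactly the indices in \<open>D\<close>, but
    not \<open>m + 1\<close>.\<close>
  have top: "msign {X m} (X ` insert (m + 1) D) = ((-1) ^ card D :: 'k)"
    if "finite D" "\<And>x. x \<in> D \<Longrightarrow> x + 2 \<le> m" for D
  proof -
    have "gless (X x) (X m)" if "x \<in> D" for x using \<open>\<And>x. x \<in> D \<Longrightarrow> x + 2 \<le> m\<close>[OF that] by simp
    then have "{(a, b). a \<in> {X m} \<and> b \<in> X ` insert (m + 1) D \<and> gless b a} = (\<lambda>x. (X m, X x)) ` D"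
      by auto
    then show ?thesis by (simp add: msign_def card_image inj_on_def)
  qed
  have drop: "msign (X ` D) (X ` insert (m + 1) D') = (msign (X ` D) (X ` D') :: 'k)"
    if "\<And>x. x \<in> D \<Longrightarrow> x + 2 \<le> m" for D D'
  proof -
    have "\<not> gless (X (m + 1)) (X x)" if "x \<in> D" for x using \<open>\<And>x. x \<in> D \<Longrightarrow> x + 2 \<le> m\<close>[OF that] by simp
    then have "{(a, b). a \<in> X ` D \<and> b \<in> X ` insert (m + 1) D' \<and> gless b a}
        = {(a, b). a \<in> X ` D \<and> b \<in> X ` D' \<and> gless b a}"
      by auto
    then show ?thesis by (simp only: msign_def)
  qed
  have "B1 (W A n) (W B m) = (\<lambda>z. msign {X m} (X ` insert (m + 1) B) * msign (X ` ?P) (X ` insert (m + 1) B)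
      * W (?P \<union> insert (m + 1) B) (m + 3) z :: 'k)"
    using B1_W(2)[OF A B c, where ?'k='k] unfolding Q unfolding both(2) unfolding both(1)[symmetric]
    by (simp only: mult_1_right)
  then have f1: "B1 (W A n) (W B m) = (\<lambda>z. (-1) ^ card B * msign (X ` ?P) (X ` B)
      * W (?P \<union> insert (m + 1) B) (m + 3) z :: 'k)"
    by (simp only: top[OF fin(2) Bm] drop[OF Pm])
  have eqs: "B \<union> C m k' = B" "m + 3 * k' = m" "n + 3 * l' = m + 3"
    using both by simp_all
  have un: "B \<union> insert (m + 1) ?P = ?P \<union> insert (m + 1) B" by auto
  have "B1 (W B m) (W A n) = (\<lambda>z. msign {X m} (X ` insert (m + 1) ?P) * msign (X ` B) (X ` insert (m + 1) ?P)
      * W (?P \<union> insert (m + 1) B) (m + 3) z :: 'k)"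
    using B1_W(2)[OF B A c', where ?'k='k] unfolding Q' unfolding eqs unfolding un .
  then have f2: "B1 (W B m) (W A n) = (\<lambda>z. (-1) ^ card ?P * msign (X ` B) (X ` ?P)
      * W (?P \<union> insert (m + 1) B) (m + 3) z :: 'k)"
    by (simp only: top[OF fin(3) Pm] drop[OF Bm])
  \<comment> \<open>Exchanging \<open>?P\<close> and \<open>B\<close> costs
    \<open>card ?P * card B\<close>. The tail \<open>C n k\<close> has even size, so
    \<open>card ?P\<close> has the parity of \<open>card A\<close>.\<close>
  have key: "(-1) ^ card B * msign (X ` ?P) (X ` B)
      = - ((-1) ^ (Suc (card A) * Suc (card B)) * ((-1) ^ card ?P * msign (X ` B) (X ` ?P)) :: 'k)"
  proof -
    have "msign (X ` ?P) (X ` B) * msign (X ` B) (X ` ?P) = ((-1) ^ (card ?P * card B) :: 'k)"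
      using fin PB by (subst msign_swap) (auto simp: card_X_image)
    then have "msign (X ` ?P) (X ` B) * msign (X ` B) (X ` ?P) * msign (X ` B) (X ` ?P)
        = ((-1) ^ (card ?P * card B) * msign (X ` B) (X ` ?P) :: 'k)" by simp
    then have sw: "msign (X ` ?P) (X ` B) = ((-1) ^ (card ?P * card B) * msign (X ` B) (X ` ?P) :: 'k)"
      by (simp only: mult.assoc msign_square mult_1_right)
    have "A \<inter> C n k = {}" using A by (rule good_C_disjoint)
    then have "card ?P = card A + card (C n k)" using fin by (simp add: card_Un_disjoint)
    then have "even (card ?P) \<longleftrightarrow> even (card A)" using even_card_C[of n k] by simp
    then have "(-1::'k) ^ (card B + card ?P * card B) = (-1) ^ Suc (Suc (card A) * Suc (card B) + card ?P)"
      by (intro minus_one_power_cong) auto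
    then have pw: "(-1::'k) ^ card B * (-1) ^ (card ?P * card B)
        = - ((-1) ^ (Suc (card A) * Suc (card B)) * (-1) ^ card ?P)"
      by (simp only: power_add power_Suc mult_minus1)
    have "(-1::'k) ^ card B * ((-1) ^ (card ?P * card B) * c)
        = - ((-1) ^ (Suc (card A) * Suc (card B)) * ((-1) ^ card ?P * c))" for c
      using arg_cong[OF pw, of "\<lambda>x. x * c"] by (simp only: mult.assoc mult_minus_left)
    then show ?thesis unfolding sw .
  qed
  show ?thesis
    unfolding f1 f2 key by (simp only: mult.assoc mult_minus_left simp_thms)
next
  case False
  then show ?thesis using B1_W_eq_0 by blast
qed

lemma B1_W_swap:
  assumes A: "good A n" and B: "good B m"
  shows "B1 (W A n) (W B m) = (\<lambda>z. 0 :: 'k::comm_ring_1) \<or> B1 (W B m) (W A n) = (\<lambda>z. 0 :: 'k) \<or>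
    B1 (W A n) (W B m) = (\<lambda>z. - ((-1) ^ (Suc (card A) * Suc (card B)) * B1 (W B m) (W A n) z :: 'k))"
proof (cases "n \<le> m")
  case True
  with B1_W_swap_le[OF assms] show ?thesis .
next
  case False
  then have "m \<le> n" by simp
  from B1_W_swap_le[OF B A this, where ?'k='k] show ?thesis
    by (elim disjE) (simp_all add: fun_eq_iff mult.commute[of "Suc (card A)"] del: mult_Suc mult_Suc_right)
qed

section \<open>The Poisson algebra is spanned by products of monomial multiples\<close>

lemma Pois_zero: "(\<lambda>m. 0) \<in> Pois"
  using Pois.smult[OF Pois.one, of 0] by simp

lemma hom_W_sign: "(-1::'k::comm_ring_1) ^ ((Suc a mod 2) * (Suc b mod 2)) = (-1) ^ (Suc a * Suc b)"
  by (rule minus_one_power_cong) (simp only: even_mult_iff even_mod_2_iff)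

text \<open>Either one of the two first-order terms vanishes and the other one is the bracket up to sign,
  or they agree up to sign and the bracket is twice the first-order term.\<close>

lemma B1_W_Pois:
  assumes two: "(2::'k::field) \<noteq> 0"
    and A: "good A n" "(W A n :: 'k fsum) \<in> Pois" and B: "good B m" "(W B m :: 'k fsum) \<in> Pois"
  shows "(B1 (W A n) (W B m) :: 'k fsum) \<in> Pois"
proof -
  let ?a = "W A n :: 'k fsum" and ?b = "W B m :: 'k fsum"
  let ?s = "(-1::'k) ^ (Suc (card A) * Suc (card B))"
  have br: "pbracket ?a ?b z = B1 ?a ?b z - ?s * B1 ?b ?a z" for z
    using pbracket_hom[OF W_Htilde[OF A(1)] W_Htilde[OF B(1)] W_hom[OF A(1)] W_hom[OF B(1)], of z]
    by (simp only: hom_W_sign)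
  have bP: "pbracket ?a ?b \<in> Pois" using A B by (intro Pois.brk)
  from B1_W_swap[OF A(1) B(1), where ?'k='k]
  consider "B1 ?a ?b = (\<lambda>z. 0)" | "B1 ?b ?a = (\<lambda>z. 0)" | "B1 ?a ?b = (\<lambda>z. - (?s * B1 ?b ?a z))"
    by blast
  then show ?thesis
  proof cases
    case 1
    then show ?thesis by (simp add: Pois_zero)
  next
    case 2
    then have "pbracket ?a ?b = B1 ?a ?b" by (simp add: br fun_eq_iff)
    with bP show ?thesis by simp
  next
    case 3
    then have "?s * B1 ?b ?a z = - B1 ?a ?b z" for z
      by (simp only: minus_minus)
    then have "B1 ?a ?b = (\<lambda>z. (1 / 2) * pbracket ?a ?b z)"
      using two by (simp add: br)
    with Pois.smult[OF bP, of "1 / 2"] show ?thesis by simp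
  qed
qed

text \<open>The sign \<open>e\<close> is its own inverse, so scaling \<open>B1\<close> back shows
  that the new monomial multiple itself lies in \<open>Pois\<close>. If \<open>B1\<close> vanishes,
  the scalar 0 with the old element serves.\<close>

lemma B1_W_scaled_W:
  assumes "(2::'k::field) \<noteq> 0" "good A n" "(W A n :: 'k fsum) \<in> Pois" "good B m" "(W B m :: 'k fsum) \<in> Pois"
  obtains c D p where "good D p" "(W D p :: 'k fsum) \<in> Pois" "B1 (W A n) (W B m) = (\<lambda>z. c * W D p z :: 'k)"
proof (rule B1_W_cases[OF assms(2,4), where ?'k='k])
  assume "B1 (W A n) (W B m) = (\<lambda>z. 0 :: 'k)"
  then show thesis using assms by (intro that[of A n 0]) auto
next
  fix e :: 'k and D p
  assume *: "good D p" "e * e = 1" "B1 (W A n) (W B m) = (\<lambda>z. e * W D p z)"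
  have "(\<lambda>z. e * B1 (W A n) (W B m) z) \<in> Pois"
    using assms by (intro Pois.smult B1_W_Pois)
  then have "W D p \<in> (Pois :: 'k fsum set)"
    by (simp add: * flip: mult.assoc)
  with * show thesis by (intro that)
qed

text \<open>The index counts factors: it gives the span of products of exactly \<open>k\<close>
  monomial multiples lying in \<open>Pois\<close>. The count is the induction measure in
  \<open>star_prods_PT\<close>.\<close>

inductive prods :: "nat \<Rightarrow> 'k::field fsum \<Rightarrow> bool" where
  one: "prods 0 gone"
| zero: "prods k (\<lambda>m. 0)"
| mult: "good A n \<Longrightarrow> (W A n :: 'k fsum) \<in> Pois \<Longrightarrow> prods k w \<Longrightarrow> prods (Suc k) (gmult (W A n) w)"
| add: "prods k f \<Longrightarrow> prods k g \<Longrightarrow> prods k (\<lambda>m. f m + g m)"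
| smult: "prods k f \<Longrightarrow> prods k (\<lambda>m. c * f m)"

lemma Htilde_zero: "(\<lambda>m. 0) \<in> Htilde"
  and Htilde_gone: "gone \<in> Htilde"
  and Htilde_add: "f \<in> Htilde \<Longrightarrow> g \<in> Htilde \<Longrightarrow> (\<lambda>m. f m + g m) \<in> Htilde"
  and Htilde_cmult: "f \<in> Htilde \<Longrightarrow> (\<lambda>m. c * f m) \<in> Htilde"
proof -
  show "(\<lambda>m. f m + g m) \<in> Htilde" if "f \<in> Htilde" "g \<in> Htilde"
    using that unfolding Htilde_def mem_Collect_eq by (metis add.right_neutral)
  show "(\<lambda>m. c * f m) \<in> Htilde" if "f \<in> Htilde"
    using that unfolding Htilde_def mem_Collect_eq by (metis mult_zero_right)
qed (auto simp: Htilde_def gone_def adm_def)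

lemma prods_Htilde: "prods k f \<Longrightarrow> f \<in> Htilde"
  by (induction rule: prods.induct)
    (auto intro: Htilde_zero Htilde_gone Htilde_add Htilde_cmult gmult_Htilde W_Htilde)

lemma prods_Pois: "prods k f \<Longrightarrow> f \<in> Pois"
  by (induction rule: prods.induct) (auto intro: Pois_zero Pois.intros)

lemma gmult_gone:
  assumes "f \<in> Htilde"
  shows "gmult gone f = f" "gmult f gone = f"
  using gmult_gone_left[of _ f] gmult_gone_right[of _ f] Htilde_infinite[OF assms]
  by (auto simp: fun_eq_iff gmult_infinite) (metis gmult_infinite)+

lemma prods_gmult: "prods j f \<Longrightarrow> prods k g \<Longrightarrow> prods (j + k) (gmult f g)"
proof (induction rule: prods.induct)
  case one
  then show ?case by (simp add: gmult_gone prods_Htilde)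
next
  case (zero k)
  then show ?case using prods.zero[of "k + _"] by (metis ext gmult_zero(1))
next
  case (mult A n k w)
  then show ?case by (simp add: gmult_assoc prods.mult)
next
  case (add k f g')
  then show ?case by (simp add: gmult_add_left[abs_def] prods.add)
next
  case (smult k f c)
  then show ?case by (simp add: gmult_cmult_left[abs_def] prods.smult)
qed

lemma B1_W_prods:
  assumes two: "(2::'k::field) \<noteq> 0" and A: "good A n" "(W A n :: 'k fsum) \<in> Pois"
  shows "prods k (w :: 'k fsum) \<Longrightarrow> prods k (B1 (W A n) w)"
proof (induction rule: prods.induct)
  case one
  have "LD c gone = (\<lambda>m. 0 :: 'k)" for c
    by (auto simp: LD_def gone_def)
  then have "B1 (W A n) gone = (\<lambda>m. 0 :: 'k)" by (simp add: B1_def)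
  then show ?case by (simp add: prods.zero)
next
  case (zero k)
  have "B1 (W A n) (\<lambda>m. 0) = (\<lambda>m. 0 :: 'k)"
    using B1_cmult_right[of "W A n" 0 "\<lambda>m. 0 :: 'k"] by simp
  then show ?case by (simp add: prods.zero)
next
  case (mult B m k w)
  obtain c D p where D: "good D p" "(W D p :: 'k fsum) \<in> Pois" "B1 (W A n) (W B m) = (\<lambda>z. c * W D p z :: 'k)"
    using B1_W_scaled_W[OF two A mult(1,2)] .
  have "B1 (W A n) (gmult (W B m) w) = (\<lambda>z. c * gmult (W D p) w z
      + (-1) ^ ((Suc (card A) mod 2) * (Suc (card B) mod 2)) * gmult (W B m) (B1 (W A n) w) z)"
    unfolding B1_gmult[OF W_hom[OF A(1)] W_hom[OF mult(1)] W_Htilde[OF mult(1)] prods_Htilde[OF mult(3)]]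
      D(3) gmult_cmult_left ..
  then show ?case
    using mult D by (auto intro!: prods.add prods.smult prods.mult)
next
  case (add k f g)
  then show ?case by (simp add: B1_add_right prods.add)
next
  case (smult k f c)
  then show ?case by (simp add: B1_cmult_right prods.smult)
qed

inductive_set Alg :: "'k::field fsum set" where
  prods: "prods k f \<Longrightarrow> f \<in> Alg"
| add: "f \<in> Alg \<Longrightarrow> g \<in> Alg \<Longrightarrow> (\<lambda>m. f m + g m) \<in> Alg"

lemma Alg_Htilde: "f \<in> Alg \<Longrightarrow> f \<in> Htilde"
  by (induction rule: Alg.induct) (auto intro: prods_Htilde Htilde_add)

lemma Alg_Pois: "f \<in> Alg \<Longrightarrow> f \<in> Pois"
  by (induction rule: Alg.induct) (auto intro: prods_Pois Pois.add)

lemma Alg_zero: "(\<lambda>m. 0) \<in> Alg"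
  by (rule Alg.prods[OF prods.zero])

lemma Alg_smult: "f \<in> Alg \<Longrightarrow> (\<lambda>m. c * f m) \<in> Alg"
proof (induction rule: Alg.induct)
  case (add f g)
  then show ?case by (simp add: distrib_left Alg.add)
qed (auto intro: Alg.prods prods.smult)

lemma Alg_gmult:
  assumes "f \<in> Alg" "g \<in> Alg"
  shows "gmult f g \<in> Alg"
  using assms(1)
proof (induction rule: Alg.induct)
  case f: (prods j f)
  show ?case using assms(2)
  proof (induction rule: Alg.induct)
    case (prods k g)
    show ?case by (rule Alg.prods[OF prods_gmult[OF f prods]])
  qed (simp add: gmult_add_right[abs_def] Alg.add)
qed (simp add: gmult_add_left[abs_def] Alg.add)

lemma W_Alg:
  assumes "good A n" "(W A n :: 'k::field fsum) \<in> Pois"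
  shows "(W A n :: 'k fsum) \<in> Alg"
  using Alg.prods[OF prods.mult[OF assms prods.one]] by (simp add: gmult_gone W_Htilde assms)

lemma B1_W_Alg:
  assumes "(2::'k::field) \<noteq> 0" "good A n" "(W A n :: 'k fsum) \<in> Pois" "(f :: 'k fsum) \<in> Alg"
  shows "B1 (W A n) f \<in> Alg"
  using assms(4)
proof (induction rule: Alg.induct)
  case (prods k f)
  then show ?case using B1_W_prods assms(1-3) by (intro Alg.prods)
qed (simp add: B1_add_right Alg.add)

lemma gmult_hom:
  assumes "hom p f" "hom q g"
  shows "hom ((p + q) mod 2) (gmult f g)"
  using star_hom[OF assms, of 0] by (simp add: gmult_eq_star)

lemma hom_zero: "hom p (\<lambda>m. 0)" by (simp add: hom_def)

lemma hom_add: "hom p f \<Longrightarrow> hom p g \<Longrightarrow> hom p (\<lambda>m. f m + g m :: 'k::comm_ring_1)"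
  unfolding hom_def by (metis add.right_neutral)

lemma hom_cmult: "hom p f \<Longrightarrow> hom p (\<lambda>m. c * f m :: 'k::comm_ring_1)"
  unfolding hom_def by (metis mult_zero_right)

text \<open>Every generator \<open>W A n\<close> is homogeneous, so multiplying by it permutes the
  two parity parts. The bracket formula \<open>pbracket_hom\<close> is available only for
  homogeneous arguments.\<close>

lemma prods_parity_split:
  "prods k f \<Longrightarrow> \<exists>f0 f1. prods k f0 \<and> prods k f1 \<and> hom 0 f0 \<and> hom 1 f1 \<and> f = (\<lambda>m. f0 m + f1 m)"
proof (induction rule: prods.induct)
  case one
  show ?case
    by (rule exI[of _ gone], rule exI[of _ "\<lambda>m. 0"])
      (simp add: prods.one prods.zero hom_zero, simp add: hom_def gone_def)
next
  case (zero k)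
  show ?case
    by (rule exI[of _ "\<lambda>m. 0"], rule exI[of _ "\<lambda>m. 0"]) (auto intro: prods.intros hom_zero)
next
  case (mult A n k w)
  then obtain w0 w1 where w: "prods k w0" "prods k w1" "hom 0 w0" "hom 1 w1" "w = (\<lambda>m. w0 m + w1 m)" by blast
  have s: "prods (Suc k) (gmult (W A n) w0)" "prods (Suc k) (gmult (W A n) w1)"
    using w mult by (auto intro: prods.mult)
  have e: "gmult (W A n) w = (\<lambda>m. gmult (W A n) w0 m + gmult (W A n) w1 m)"
    by (simp add: w(5) gmult_add_right[abs_def])
  have h: "hom ((Suc (card A) mod 2 + 0) mod 2) (gmult (W A n) w0)"
    "hom ((Suc (card A) mod 2 + 1) mod 2) (gmult (W A n) w1)"
    by (rule gmult_hom[OF W_hom[OF mult(1)] w(3)], rule gmult_hom[OF W_hom[OF mult(1)] w(4)])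
  show ?case
  proof (cases "even (card A)")
    case True
    then have "Suc (card A) mod 2 = 1" by presburger
    with h s e show ?thesis
      by (intro exI[of _ "gmult (W A n) w1"] exI[of _ "gmult (W A n) w0"]) (auto simp: add.commute)
  next
    case False
    then have "Suc (card A) mod 2 = 0" by presburger
    with h s e show ?thesis
      by (intro exI[of _ "gmult (W A n) w0"] exI[of _ "gmult (W A n) w1"]) auto
  qed
next
  case (add k f g)
  then obtain f0 f1 g0 g1 where
    "prods k f0" "prods k f1" "hom 0 f0" "hom 1 f1" "f = (\<lambda>m. f0 m + f1 m)"
    "prods k g0" "prods k g1" "hom 0 g0" "hom 1 g1" "g = (\<lambda>m. g0 m + g1 m)" by blast
  then show ?case
    by (intro exI[of _ "\<lambda>m. f0 m + g0 m"] exI[of _ "\<lambda>m. f1 m + g1 m"])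
      (auto intro: prods.add hom_add simp: add_ac)
next
  case (smult k f c)
  then obtain f0 f1 where "prods k f0" "prods k f1" "hom 0 f0" "hom 1 f1" "f = (\<lambda>m. f0 m + f1 m)" by blast
  then show ?case
    by (intro exI[of _ "\<lambda>m. c * f0 m"] exI[of _ "\<lambda>m. c * f1 m"])
      (auto intro: prods.smult hom_cmult simp: distrib_left)
qed

section \<open>Closure under the star product\<close>

text \<open>The degree bound \<open>N\<close> is uniform in \<open>m\<close>: these are polynomials
  in \<open>t\<close> over \<open>A\<close>, and not merely series with polynomial entries.\<close>

definition PT :: "'k::field fsum set \<Rightarrow> 'k fps fsum set" where
  "PT A = {F. (\<forall>n. (\<lambda>m. fps_nth (F m) n) \<in> A) \<and> (\<exists>N. \<forall>n\<ge>N. \<forall>m. fps_nth (F m) n = 0)}"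

text \<open>Horner's scheme: split off the constant term and divide the rest by \<open>t\<close>,
  which lowers the degree bound.\<close>

lemma PT_induct [consumes 1, case_names cst add shift]:
  assumes "F \<in> PT A"
    and cst: "\<And>a. a \<in> A \<Longrightarrow> Q (cst a)"
    and add: "\<And>F G. Q F \<Longrightarrow> Q G \<Longrightarrow> Q (\<lambda>m. F m + G m)"
    and shift: "\<And>F. Q F \<Longrightarrow> Q (\<lambda>m. fps_X * F m)"
  shows "Q F"
proof -
  obtain N where "\<And>n. (\<lambda>m. fps_nth (F m) n) \<in> A" "\<And>n m. n \<ge> N \<Longrightarrow> fps_nth (F m) n = 0"
    using assms(1) by (auto simp: PT_def)
  then show ?thesis
  proof (induction N arbitrary: F)
    case 0
    then have "F = cst (\<lambda>m. fps_nth (F m) 0)"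
      by (simp add: cst_def fun_eq_iff fps_eq_iff)
    then show ?case using cst[OF 0(1), of 0] by simp
  next
    case (Suc N)
    define G where "G = (\<lambda>m. Abs_fps (\<lambda>n. fps_nth (F m) (Suc n)))"
    have "Q G" by (rule Suc.IH) (use Suc.prems in \<open>auto simp: G_def\<close>)
    moreover have "F = (\<lambda>m. cst (\<lambda>m. fps_nth (F m) 0) m + fps_X * G m)"
      by (auto simp: fun_eq_iff fps_eq_iff cst_def G_def)
    ultimately show ?case
      using add[OF cst[OF Suc.prems(1), of 0] shift] by metis
  qed
qed

lemma PT_cst: "a \<in> Alg \<Longrightarrow> cst a \<in> PT Alg"
  unfolding PT_def
proof (intro CollectI conjI allI exI[of _ 1] impI)
  fix n assume "a \<in> Alg"
  then show "(\<lambda>m. fps_nth (cst a m) n) \<in> Alg" using Alg_zero by (cases n) (simp_all add: cst_def)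
qed (simp add: cst_def)

lemma PT_add:
  assumes "F \<in> PT Alg" "G \<in> PT Alg"
  shows "(\<lambda>m. F m + G m) \<in> PT Alg"
proof -
  obtain N N' where "\<forall>n\<ge>N. \<forall>m. fps_nth (F m) n = 0" "\<forall>n\<ge>N'. \<forall>m. fps_nth (G m) n = 0"
    using assms by (auto simp: PT_def)
  then have "\<forall>n\<ge>max N N'. \<forall>m. fps_nth (F m + G m) n = 0" by simp
  moreover have "(\<lambda>m. fps_nth (F m + G m) n) \<in> Alg" for n
    using assms by (auto simp: PT_def intro: Alg.add)
  ultimately show ?thesis unfolding PT_def by blast
qed

lemma PT_const_mult:
  assumes "F \<in> PT Alg"
  shows "(\<lambda>m. fps_const c * F m) \<in> PT Alg"
  using assms by (auto simp: PT_def intro: Alg_smult)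

lemma PT_shift:
  assumes "F \<in> PT Alg"
  shows "(\<lambda>m. fps_X * F m) \<in> PT Alg"
proof -
  obtain N where "\<forall>n\<ge>N. \<forall>m. fps_nth (F m) n = 0" using assms by (auto simp: PT_def)
  then have "\<forall>n\<ge>Suc N. \<forall>m. fps_nth (fps_X * F m) n = 0" by (auto simp: Suc_le_eq)
  moreover have "(\<lambda>m. fps_nth (fps_X * F m) n) \<in> Alg" for n
    using assms Alg_zero by (cases n) (auto simp: PT_def)
  ultimately show ?thesis unfolding PT_def by blast
qed

lemma cst_Htilde: "f \<in> Htilde \<Longrightarrow> cst f \<in> Htilde"
  by (auto simp: Htilde_def cst_def)

lemma PT_Htilde: "F \<in> PT A \<Longrightarrow> A \<subseteq> Htilde \<Longrightarrow> F \<in> Htilde"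
  by (induction rule: PT_induct) (auto intro: cst_Htilde Htilde_add Htilde_cmult)

lemma star_cst_W:
  "star fps_X (cst (W A n)) (cst f) = (\<lambda>m. cst (gmult (W A n) f) m + fps_X * cst (B1 (W A n) f) m)"
proof -
  have "star fps_X (cst (W A n)) (cst f)
      = (\<lambda>m. gmult (cst (W A n)) (cst f) m + fps_X * B1 (cst (W A n)) (cst f) m)"
    by (rule star_ylinear) (use W_ylinear in \<open>fastforce simp: cst_def\<close>)
  then show ?thesis by (simp add: cst_gmult cst_B1)
qed

lemma star_W_PT:
  assumes "(2::'k::field) \<noteq> 0" "good A n" "(W A n :: 'k fsum) \<in> Pois" "(G :: 'k fps fsum) \<in> PT Alg"
  shows "star fps_X (cst (W A n)) G \<in> PT Alg"
  using assms(4)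
proof (induction rule: PT_induct)
  case (cst b)
  have "gmult (W A n) b \<in> Alg" using assms cst by (intro Alg_gmult W_Alg)
  moreover have "B1 (W A n) b \<in> Alg" using assms cst by (intro B1_W_Alg)
  ultimately show ?case unfolding star_cst_W by (intro PT_add PT_shift PT_cst)
qed (simp_all add: star_add_right star_cmult_right PT_add PT_shift)

text \<open>After associativity is applied to \<open>v w\<close>, the left factors that remain
  besides \<open>v\<close> are \<open>w\<close> and \<open>B1 v w\<close>; both have one factor
  fewer than \<open>v w\<close>.\<close>

lemma star_prods_PT:
  assumes two: "(2::'k::field) \<noteq> 0" and G: "(G :: 'k fps fsum) \<in> PT Alg"
  shows "prods k f \<Longrightarrow> star fps_X (cst f) G \<in> PT Alg"
proof (induction k arbitrary: f)
  have GH: "G \<in> Htilde" using G Alg_Htilde by (intro PT_Htilde) auto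
  have z: "star fps_X (cst (\<lambda>m. 0)) G \<in> PT Alg"
    using star_cmult_left[of fps_X 0 "\<lambda>m. 0" G] PT_cst[OF Alg_zero] by (simp add: cst_def)
  {
    case 0
    then show ?case
    proof (induction "0::nat" f rule: prods.induct)
      case one
      have "cst (gone :: 'k fsum) = gone" by (simp add: cst_def gone_def fun_eq_iff)
      then show ?case using G GH by (simp add: star_gone_left)
    qed (simp_all add: z cst_add cst_cmult star_add_left star_cmult_left PT_add PT_const_mult)
  next
    case (Suc k)
    from Suc.prems show ?case
    proof (induction "Suc k" f rule: prods.induct)
      case (mult A n w)
      let ?v = "W A n :: 'k fsum"
      have "star fps_X (star fps_X (cst ?v) (cst w)) G = star fps_X (cst ?v) (star fps_X (cst w) G)"
        using mult GH by (intro star_assoc cst_Htilde prods_Htilde)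
      \<comment> \<open>Written as a constant series, the sign falls under
        \<open>PT_const_mult\<close>.\<close>
      moreover have "fps_const (-1) = (-1 :: 'k fps)" by (simp flip: fps_const_neg)
      ultimately have "star fps_X (cst (gmult ?v w)) G = (\<lambda>m. star fps_X (cst ?v) (star fps_X (cst w) G) m
          + fps_const (-1) * (fps_X * star fps_X (cst (B1 ?v w)) G m))"
        by (simp add: star_cst_W star_add_left star_cmult_left fun_eq_iff eq_diff_eq)
      moreover have "star fps_X (cst ?v) (star fps_X (cst w) G) \<in> PT Alg"
        using two mult Suc.IH by (intro star_W_PT)
      moreover have "star fps_X (cst (B1 ?v w)) G \<in> PT Alg"
        using two mult by (intro Suc.IH B1_W_prods)
      ultimately show ?case
        by (simp only: PT_add PT_const_mult PT_shift)
    qed (simp_all add: z cst_add cst_cmult star_add_left star_cmult_left PT_add PT_const_mult)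
  }
qed

lemma star_PT:
  assumes two: "(2::'k::field) \<noteq> 0" and F: "(F :: 'k fps fsum) \<in> PT Alg" and G: "G \<in> PT Alg"
  shows "star fps_X F G \<in> PT Alg"
  using F
proof (induction rule: PT_induct)
  case (cst a)
  then show ?case
  proof (induction rule: Alg.induct)
    case (prods k f)
    then show ?case by (rule star_prods_PT[OF two G])
  qed (simp add: cst_add star_add_left PT_add)
qed (simp_all add: star_add_left star_cmult_left PT_add PT_shift)

section \<open>The generated algebra is closed under the bracket and equals
  \<open>Pois\<close>\<close>

lemma B1_Alg:
  assumes two: "(2::'k::field) \<noteq> 0" and f: "(f :: 'k fsum) \<in> Alg" and g: "g \<in> Alg"
  shows "B1 f g \<in> Alg"
proof -
  have "star fps_X (cst f) (cst g) \<in> PT Alg"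
    using assms by (intro star_PT PT_cst)
  then have "(\<lambda>m. fps_nth (star fps_X (cst f) (cst g) m) 1) \<in> Alg"
    by (simp only: PT_def mem_Collect_eq)
  then show ?thesis by (simp only: star_nth_1)
qed

text \<open>For homogeneous arguments the bracket is a combination of two \<open>B1\<close> terms.
  The general case follows by splitting first the left and then the right argument by
  parity.\<close>

lemma pbracket_Alg:
  assumes two: "(2::'k::field) \<noteq> 0" and "(f :: 'k fsum) \<in> Alg" "g \<in> Alg"
  shows "pbracket f g \<in> Alg"
proof -
  have hom: "pbracket f g \<in> Alg" if "f \<in> Alg" "g \<in> Alg" "hom p f" "hom q g" for f g :: "'k fsum" and p q
  proof -
    have "pbracket f g = (\<lambda>m. B1 f g m + (- ((-1) ^ (p * q))) * B1 g f m)"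
      using that by (simp add: fun_eq_iff pbracket_hom[OF _ _ that(3,4)] Alg_Htilde)
    then show ?thesis
      by (simp only:) (intro Alg.add Alg_smult B1_Alg two that)
  qed
  have left: "pbracket f g \<in> Alg" if "f \<in> Alg" "g \<in> Alg" "hom q g" for f g :: "'k fsum" and q
    using that(1)
  proof (induction rule: Alg.induct)
    case (prods k f)
    then obtain f0 f1 where f: "prods k f0" "prods k f1" "hom 0 f0" "hom 1 f1" "f = (\<lambda>m. f0 m + f1 m)"
      using prods_parity_split by blast
    then have "pbracket f g = (\<lambda>m. pbracket f0 g m + pbracket f1 g m)"
      using that(2) unfolding f(5) by (intro pbracket_add_left Htilde_add) (auto intro: prods_Htilde Alg_Htilde)
    then show ?case
      using f hom[OF _ that(2) _ that(3)] by (simp add: Alg.add Alg.prods)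
  next
    case (add f f')
    then have "pbracket (\<lambda>m. f m + f' m) g = (\<lambda>m. pbracket f g m + pbracket f' g m)"
      using that(2) by (intro pbracket_add_left Htilde_add) (auto intro: Alg_Htilde)
    with add show ?case by (simp add: Alg.add)
  qed
  show ?thesis
    using assms(3)
  proof (induction rule: Alg.induct)
    case (prods k g)
    then obtain g0 g1 where g: "prods k g0" "prods k g1" "hom 0 g0" "hom 1 g1" "g = (\<lambda>m. g0 m + g1 m)"
      using prods_parity_split by blast
    then have "pbracket f g = (\<lambda>m. pbracket f g0 m + pbracket f g1 m)"
      using assms(2) unfolding g(5) by (intro pbracket_add_right Htilde_add) (auto intro: prods_Htilde Alg_Htilde)
    then show ?case
      using g left[OF assms(2)] by (simp add: Alg.add Alg.prods)
  next
    case (add g g')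
    then have "pbracket f (\<lambda>m. g m + g' m) = (\<lambda>m. pbracket f g m + pbracket f g' m)"
      using assms(2) by (intro pbracket_add_right Htilde_add) (auto intro: Alg_Htilde)
    with add show ?case by (simp add: Alg.add)
  qed
qed

lemma Pois_eq_Alg:
  assumes two: "(2::'k::field) \<noteq> 0"
  shows "(Pois :: 'k fsum set) = Alg"
proof
  show "(Alg :: 'k fsum set) \<subseteq> Pois" using Alg_Pois by blast
  have V: "(V i :: 'k fsum) \<in> Alg" if "V i \<in> (Pois :: 'k fsum set)" for i
    using that W_Alg[of "{}" i, where ?'k='k] by (simp add: V_eq_W good_def)
  show "(Pois :: 'k fsum set) \<subseteq> Alg"
  proof
    fix f :: "'k fsum" assume "f \<in> Pois"
    then show "f \<in> Alg"
      by (induction rule: Pois.induct)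
        (use V[OF Pois.V0] V[OF Pois.V1] V[OF Pois.V2] in \<open>auto intro: Alg.prods prods.one Alg.add Alg_smult Alg_gmult pbracket_Alg[OF two]\<close>)
  qed
qed

section \<open>Transfer to sequences of coefficients\<close>

text \<open>Exchanging the arguments \<open>n\<close> and \<open>m\<close> turns a sequence of
  coefficients into a formal sum over power series, where \<open>star\<close> is defined.\<close>

definition toF :: "(nat \<Rightarrow> 'k::field fsum) \<Rightarrow> 'k fps fsum" where
  "toF F = (\<lambda>m. Abs_fps (\<lambda>n. F n m))"

definition frF :: "'k::field fps fsum \<Rightarrow> nat \<Rightarrow> 'k fsum" where
  "frF f = (\<lambda>n m. fps_nth (f m) n)"

lemma toF_frF [simp]: "toF (frF f) = f"
  by (simp add: toF_def frF_def fps_eq_iff fun_eq_iff)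

lemma frF_toF [simp]: "frF (toF F) = F"
  by (simp add: toF_def frF_def fun_eq_iff)

text \<open>Only finitely many nonzero coefficient functions means exactly a degree bound common to
  all monomials.\<close>

lemma Pt_iff_PT: "F \<in> Pt \<longleftrightarrow> toF F \<in> PT Pois"
proof -
  have "finite {n. F n \<noteq> (\<lambda>_. 0)} \<longleftrightarrow> (\<exists>N. \<forall>n\<ge>N. \<forall>m. F n m = 0)"
    unfolding finite_nat_set_iff_bounded by (auto simp: fun_eq_iff) (metis not_le)+
  then show ?thesis by (auto simp: Pt_def PT_def toF_def)
qed

lemma toF_tadd: "toF (tadd F G) = (\<lambda>m. toF F m + toF G m)"
  and toF_tsmult: "toF (tsmult c F) = (\<lambda>m. fps_const c * toF F m)"
  and toF_tconst: "toF (tconst a) = cst a"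
  and toF_tvar: "toF tvar = (\<lambda>m. fps_X * gone m)"
  and toF_tshift: "toF (tshift F) = (\<lambda>m. fps_X * toF F m)"
  by (auto simp: toF_def tadd_def tsmult_def tconst_def tvar_def tshift_def cst_def gone_def fps_eq_iff fun_eq_iff)

lemma hom_toF_iff: "hom p (toF F) \<longleftrightarrow> (\<forall>n. hom p (F n))"
  by (auto simp: hom_def toF_def fps_eq_iff)

theorem theorem10p7:
  assumes "CHAR('k::field) \<noteq> 2"
  shows "\<exists>star :: (nat \<Rightarrow> 'k fsum) \<Rightarrow> (nat \<Rightarrow> 'k fsum) \<Rightarrow> (nat \<Rightarrow> 'k fsum).
    (\<forall>F\<in>Pt. \<forall>G\<in>Pt. star F G \<in> Pt)
  \<and> (\<forall>F\<in>Pt. \<forall>G\<in>Pt. \<forall>H\<in>Pt. star (tadd F G) H = tadd (star F H) (star G H)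
                          \<and> star H (tadd F G) = tadd (star H F) (star H G))
  \<and> (\<forall>c. \<forall>F\<in>Pt. \<forall>G\<in>Pt. star (tsmult c F) G = tsmult c (star F G)
                       \<and> star F (tsmult c G) = tsmult c (star F G))
  \<and> (\<forall>F\<in>Pt. \<forall>G\<in>Pt. \<forall>H\<in>Pt. star (star F G) H = star F (star G H))
  \<and> (\<forall>p q F G. p < 2 \<longrightarrow> q < 2 \<longrightarrow> F \<in> Pt \<longrightarrow> G \<in> Pt \<longrightarrow>
        (\<forall>n. hom p (F n)) \<longrightarrow> (\<forall>n. hom q (G n)) \<longrightarrow>
        (\<forall>n. hom ((p + q) mod 2) (star F G n)))
  \<and> (\<forall>a\<in>Pois. \<forall>b\<in>Pois. star (tconst a) (tconst b) 0 = gmult a b)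
  \<and> (\<forall>p q a b. p < 2 \<longrightarrow> q < 2 \<longrightarrow> a \<in> Pois \<longrightarrow> b \<in> Pois \<longrightarrow> hom p a \<longrightarrow> hom q b \<longrightarrow>
        (\<forall>m. star (tconst a) (tconst b) 0 m - (-1) ^ (p * q) * star (tconst b) (tconst a) 0 m = 0)
      \<and> (\<forall>m. star (tconst a) (tconst b) 1 m - (-1) ^ (p * q) * star (tconst b) (tconst a) 1 m
              = pbracket a b m))
  \<and> (\<forall>F\<in>Pt. star F tvar = tshift F \<and> star tvar F = tshift F)"
proof -
  \<comment> \<open>If 2 were zero, the characteristic would divide the prime 2 without being 2,
    hence be 1, which is impossible in a field.\<close>
  have two: "(2::'k) \<noteq> 0"
  proof
    assume "(2::'k) = 0"
    then have "of_nat 2 = (0::'k)" by simp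
    then have "CHAR('k) dvd 2" by (simp only: of_nat_eq_0_iff_char_dvd)
    then have "CHAR('k) = 1" using assms by (metis prime_nat_iff two_is_prime_nat)
    then show False by simp
  qed
  define st :: "(nat \<Rightarrow> 'k fsum) \<Rightarrow> (nat \<Rightarrow> 'k fsum) \<Rightarrow> nat \<Rightarrow> 'k fsum"
    where "st F G = frF (star fps_X (toF F) (toF G))" for F G
  have toF_st: "toF (st F G) = star fps_X (toF F) (toF G)" for F G by (simp add: st_def)
  have toF_inj: "F = G" if "toF F = toF G" for F G :: "nat \<Rightarrow> 'k fsum"
    using that by (metis frF_toF)
  have PoisH: "a \<in> Htilde" if "a \<in> Pois" for a :: "'k fsum"
    using that Alg_Htilde Pois_eq_Alg[OF two] by blast
  have H: "toF F \<in> Htilde" if "F \<in> Pt" for F :: "nat \<Rightarrow> 'k fsum"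
    using that PoisH by (intro PT_Htilde[of _ Pois]) (auto simp: Pt_iff_PT)
  have st0: "st (tconst a) (tconst b) 0 m = gmult a b m" for a b m
    by (simp add: st_def frF_def toF_tconst star_nth_0)
  have st1: "st (tconst a) (tconst b) 1 m = B1 a b m" for a b m
    unfolding st_def frF_def toF_tconst by (rule star_nth_1)
  show ?thesis
  proof (rule exI[of _ st], intro conjI allI ballI impI)
    fix F G H :: "nat \<Rightarrow> 'k fsum" and c p q n
    show "st F G \<in> Pt" if "F \<in> Pt" "G \<in> Pt"
      using that star_PT[OF two] unfolding Pt_iff_PT toF_st Pois_eq_Alg[OF two] by blast
    show "st (tadd F G) H = tadd (st F H) (st G H)"
      by (rule toF_inj) (simp add: toF_st toF_tadd star_add_left)
    show "st H (tadd F G) = tadd (st H F) (st H G)"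
      by (rule toF_inj) (simp add: toF_st toF_tadd star_add_right)
    show "st (tsmult c F) G = tsmult c (st F G)"
      by (rule toF_inj) (simp add: toF_st toF_tsmult star_cmult_left)
    show "st F (tsmult c G) = tsmult c (st F G)"
      by (rule toF_inj) (simp add: toF_st toF_tsmult star_cmult_right)
    show "st (st F G) H = st F (st G H)" if "G \<in> Pt" "H \<in> Pt"
      by (rule toF_inj) (simp add: toF_st star_assoc H that)
    show "hom ((p + q) mod 2) (st F G n)" if "\<forall>n. hom p (F n)" "\<forall>n. hom q (G n)"
      using that star_hom[of p "toF F" q "toF G" fps_X] by (simp add: hom_toF_iff flip: toF_st)
    \<comment> \<open>\<open>tvar\<close> is \<open>t\<close> times the unit, so linearity over
      power series and the unit law suffice.\<close>
    show "st F tvar = tshift F" if "F \<in> Pt"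
      by (rule toF_inj) (simp add: toF_st toF_tvar toF_tshift star_cmult_right star_gone_right H that)
    show "st tvar F = tshift F" if "F \<in> Pt"
      by (rule toF_inj) (simp add: toF_st toF_tvar toF_tshift star_cmult_left star_gone_left H that)
  next
    fix a b :: "'k fsum"
    show "st (tconst a) (tconst b) 0 = gmult a b"
      by (simp add: st0 fun_eq_iff)
  next
    fix p q m and a b :: "'k fsum"
    assume ab: "a \<in> Pois" "b \<in> Pois" "hom p a" "hom q b"
    \<comment> \<open>The constant term of the supercommutator vanishes because the undeformed
      product is supercommutative.\<close>
    have "gmult a b m = (-1) ^ (p * q) * gmult b a m"
      by (rule gmult_commute_sign) (use hom_even[OF ab(3)] hom_even[OF ab(4)] in auto)
    then show "st (tconst a) (tconst b) 0 m - (-1) ^ (p * q) * st (tconst b) (tconst a) 0 m = 0"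
      by (simp add: st0)
    show "st (tconst a) (tconst b) 1 m - (-1) ^ (p * q) * st (tconst b) (tconst a) 1 m = pbracket a b m"
      unfolding st1 using pbracket_hom[OF PoisH[OF ab(1)] PoisH[OF ab(2)] ab(3,4)] by simp
  qed
qed

end
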